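(* Let $\alpha\in(0,1]$, let $f\in C^\infty(\mathbb{R},\mathbb{R})$ satisfy $f'(0)\ne0$, and let $a$ satisfy condition (A) of the context and be such that there exist a nonempty open interval $\omega\subset\mathbb{T}$ and $\delta>0$ with $a(x)\ge\delta$ for all $x\in\omega$. Let $K\ge 0$ be such that $$\inf_{s\in[-K,K]}|f'(s)|>0.$$ Then for any $u_0\in L^\infty(\mathbb{T})$ satisfying $\|u_0\|_{L^\infty(\mathbb{T})}\le K$, there exists $T>0$ such that the solution $u$ of $$\partial_t u+\partial_x(f(u))+a(x)\frac{u}{|u|^\alpha}=0\quad\text{in }\mathbb{R}_+\times\mathbb{T},\qquad u_{|t=0}=u_0,$$ satisfies $$u(t,x)=0\quad\text{for all }t\ge T\text{ and a.e. }x\in\mathbb{T}.$$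
   Context: $\mathbb{T}=\mathbb{R}/\mathbb{Z}$, $\mathbb{R}_+=[0,\infty)$. Condition (A) on $a:\mathbb{T}\to\mathbb{R}$: $a(x)\ge 0$ for all $x\in\mathbb{T}$, $a\in L^\infty(\mathbb{T})$, and $\sup_{y>0}\frac1y\int_{\mathbb{T}}|a(x+y)-a(x)|\,dx<\infty$. $\mathrm{Sign}(u)=\{1\}$ if $u>0$, $\{-1\}$ if $u<0$, $[-1,1]$ if $u=0$. For $\alpha<1$, $u/|u|^\alpha$ is understood as $0$ at $u=0$. Admissible weak solution on $[0,T]\times\mathbb{T}$ with initial datum $u_0\in L^\infty(\mathbb{T})$: (Case $0<\alpha<1$.) A bounded measurable function $u$ on $[0,T]\times\mathbb{T}$ such that, with $h(t,x)=a(x)\frac{u(t,x)}{|u(t,x)|^\alpha}$, $$\int_0^T\!\!\int_{\mathbb{T}}\big(\partial_t\psi\,\eta(u)+\partial_x\psi\,q(u)-\psi\,\eta'(u)\,h\big)\,dx\,dt+\int_{\mathbb{T}}\psi(0,x)\eta(u_0(x))\,dx\ge 0\qquad( * )$$ for every convex (hence locally Lipschitz) function $\eta:\mathbb{R}\to\mathbb{R}$, with $q$ such that $q'=f'\eta'$, and every nonnegative Lipschitz continuous $\psi$ on $[0,T]\times\mathbb{T}$ with $\psi(T,\cdot)=0$. At points where $\eta$ is not differentiable, $\eta'$ denotes the average of the left and right derivatives. (Case $\alpha=1$.) A bounded measurable function $u$ on $[0,T]\times\mathbb{T}$ for which there exists $h\in L^\infty((0,T)\times\mathbb{T})$ with $\partial_t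 u+\partial_x(f(u))+h=0$ in $\mathscr{D}'((0,T)\times\mathbb{T})$, $h(t,x)\in a(x)\,\mathrm{Sign}(u(t,x))$ for a.e. $(t,x)\in(0,T)\times\mathbb{T}$, and such that $( * )$ holds with this $h$ for every convex (hence locally Lipschitz) function $\eta:\mathbb{R}\to\mathbb{R}$, with $q$ such that $q'=f'\eta'$, and every nonnegative Lipschitz continuous $\psi$ on $[0,T]\times\mathbb{T}$ with $\psi(T,\cdot)=0$ (with $\eta'$ again denoting the average of the left and right derivatives at points where $\eta$ is not differentiable). "The solution" means the global admissible weak solution (admissible weak solution on $[0,T]\times\mathbb{T}$ for every $T>0$), which exists, is unique, and is taken in its $C^0(\mathbb{R}_+;L^1(\mathbb{T}))$ representative, so that $u(t)$ makes sense for every $t\ge 0$. *)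

theory Defs
  imports "HOL-Analysis.Analysis" "HOL-Probability.Essential_Supremum"
begin

text \<open>
  Functions on the torus \<open>\<real> / \<int>\<close> are represented by 1-periodic functions on the real line, and
  integrals over the torus by integrals over the fundamental domain \<open>[0, 1)\<close>. Functions of time and
  space are curried, \<open>u t x\<close>, with \<open>u t\<close> 1-periodic for every relevant \<open>t\<close>. All measures are the
  complete Lebesgue measures.
\<close>

definition periodic1 :: "(real \<Rightarrow> real) \<Rightarrow> bool" where
  "periodic1 g \<longleftrightarrow> (\<forall>x. g (x + 1) = g x)"

definition torus :: "real measure" where
  "torus = lebesgue_on {0..<1}"

definition cylinder :: "real set \<Rightarrow> (real \<times> real) measure" where
  "cylinder I = lebesgue_on (I \<times> {0..<1})"

definition Linf_norm :: "'a measure \<Rightarrow> ('a \<Rightarrow> real) \<Rightarrow> ereal" where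
  "Linf_norm M g = esssup M (\<lambda>x. ereal \<bar>g x\<bar>)"

definition Linf :: "'a measure \<Rightarrow> ('a \<Rightarrow> real) \<Rightarrow> bool" where
  "Linf M g \<longleftrightarrow> g \<in> borel_measurable M \<and> Linf_norm M g < \<infinity>"

definition smooth :: "(real \<Rightarrow> real) \<Rightarrow> bool" where
  "smooth f \<longleftrightarrow> (\<forall>n. (deriv ^^ n) f differentiable_on UNIV)"

definition condition_A :: "(real \<Rightarrow> real) \<Rightarrow> bool" where
  "condition_A a \<longleftrightarrow>
     periodic1 a \<and> (\<forall>x. 0 \<le> a x) \<and> Linf torus a \<and>
     bdd_above ((\<lambda>y. (1 / y) * (\<integral>x. \<bar>a (x + y) - a x\<bar> \<partial>torus)) ` {0<..})"

definition Sign :: "real \<Rightarrow> real set" where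
  "Sign u = (if 0 < u then {1} else if u < 0 then {-1} else {-1..1})"

definition dt :: "(real \<Rightarrow> real \<Rightarrow> real) \<Rightarrow> real \<Rightarrow> real \<Rightarrow> real" where
  "dt g t x = deriv (\<lambda>s. g s x) t"

definition dx :: "(real \<Rightarrow> real \<Rightarrow> real) \<Rightarrow> real \<Rightarrow> real \<Rightarrow> real" where
  "dx g t x = deriv (\<lambda>y. g t y) x"

primrec C_k :: "nat \<Rightarrow> (real \<Rightarrow> real \<Rightarrow> real) \<Rightarrow> bool" where
  "C_k 0 g \<longleftrightarrow> continuous_on UNIV (\<lambda>(t, x). g t x)"
| "C_k (Suc k) g \<longleftrightarrow>
     (\<forall>p. (\<lambda>(t, x). g t x) differentiable (at p)) \<and> C_k k (dt g) \<and> C_k k (dx g)"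

text \<open>
  Test functions on the product of \<open>(0, T)\<close> and the torus, extended by zero to all times.
  Since the torus is compact, only the support in time has to be constrained.
\<close>

definition test_function :: "real \<Rightarrow> (real \<Rightarrow> real \<Rightarrow> real) \<Rightarrow> bool" where
  "test_function T \<phi> \<longleftrightarrow>
     (\<forall>k. C_k k \<phi>) \<and> (\<forall>t. periodic1 (\<phi> t)) \<and>
     (\<exists>c d. 0 < c \<and> d < T \<and> (\<forall>t x. t \<notin> {c..d} \<longrightarrow> \<phi> t x = 0))"

text \<open>The equation \<open>\<partial>\<^sub>t u + \<partial>\<^sub>x (f u) + h = 0\<close> in the sense of distributions.\<close>

definition distributional_solution ::
    "(real \<Rightarrow> real) \<Rightarrow> real \<Rightarrow> (real \<Rightarrow> real \<Rightarrow> real) \<Rightarrow> (real \<Rightarrow> real \<Rightarrow> real) \<Rightarrow> bool" where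
  "distributional_solution f T u h \<longleftrightarrow>
     (\<forall>\<phi>. test_function T \<phi> \<longrightarrow>
        (\<integral>(t, x). dt \<phi> t x * u t x + dx \<phi> t x * f (u t x) - \<phi> t x * h t x
           \<partial>cylinder {0<..<T}) = 0)"

definition avg_deriv :: "(real \<Rightarrow> real) \<Rightarrow> real \<Rightarrow> real" where
  "avg_deriv \<eta> v =
     (if \<eta> differentiable (at v) then deriv \<eta> v
      else (vector_derivative \<eta> (at_left v) + vector_derivative \<eta> (at_right v)) / 2)"

text \<open>
  At a kink of \<open>\<eta>\<close> the flux \<open>q\<close> has no derivative in general, so \<open>q' = f' \<eta>'\<close> is required at the
  points of differentiability of \<open>\<eta>\<close> only. A convex \<open>\<eta>\<close> has at most countably many kinks, so
  continuity then determines \<open>q\<close> up to a constant: it is a primitive of \<open>f' \<eta>'\<close>.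
\<close>

definition entropy_pair ::
    "(real \<Rightarrow> real) \<Rightarrow> (real \<Rightarrow> real) \<Rightarrow> (real \<Rightarrow> real) \<Rightarrow> bool" where
  "entropy_pair f \<eta> q \<longleftrightarrow>
     convex_on UNIV \<eta> \<and> continuous_on UNIV q \<and>
     (\<forall>v. \<eta> differentiable (at v) \<longrightarrow> (q has_real_derivative deriv f v * deriv \<eta> v) (at v))"

text \<open>
  The partial derivatives of a Lipschitz \<open>\<psi>\<close> exist almost everywhere, so the values of \<open>dt \<psi>\<close> and
  \<open>dx \<psi>\<close> on the exceptional null set do not affect the integral.
\<close>

definition entropy_inequality ::
    "(real \<Rightarrow> real) \<Rightarrow> (real \<Rightarrow> real) \<Rightarrow> real \<Rightarrow> (real \<Rightarrow> real \<Rightarrow> real) \<Rightarrow>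
     (real \<Rightarrow> real \<Rightarrow> real) \<Rightarrow> bool" where
  "entropy_inequality f u0 T u h \<longleftrightarrow>
     (\<forall>\<eta> q \<psi>.
        entropy_pair f \<eta> q \<and>
        (\<forall>t\<in>{0..T}. periodic1 (\<psi> t)) \<and>
        (\<exists>L. L-lipschitz_on ({0..T} \<times> UNIV) (\<lambda>(t, x). \<psi> t x)) \<and>
        (\<forall>t\<in>{0..T}. \<forall>x. 0 \<le> \<psi> t x) \<and> (\<forall>x. \<psi> T x = 0)
        \<longrightarrow>
        0 \<le> (\<integral>(t, x). dt \<psi> t x * \<eta> (u t x) + dx \<psi> t x * q (u t x)
                       - \<psi> t x * avg_deriv \<eta> (u t x) * h t x \<partial>cylinder {0..T})
            + (\<integral>x. \<psi> 0 x * \<eta> (u0 x) \<partial>torus))"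

definition bounded_measurable :: "real \<Rightarrow> (real \<Rightarrow> real \<Rightarrow> real) \<Rightarrow> bool" where
  "bounded_measurable T u \<longleftrightarrow>
     (\<forall>t\<in>{0..T}. periodic1 (u t)) \<and>
     (\<lambda>(t, x). u t x) \<in> borel_measurable (cylinder {0..T}) \<and>
     (\<exists>M. \<forall>t\<in>{0..T}. \<forall>x. \<bar>u t x\<bar> \<le> M)"

text \<open>
  For \<open>\<alpha> < 1\<close> the convention that \<open>u / |u|\<^sup>\<alpha>\<close> is \<open>0\<close> at \<open>u = 0\<close> is met by \<open>0 / (0 powr \<alpha>) = 0\<close>.
\<close>

definition admissible_weak_solution ::
    "real \<Rightarrow> (real \<Rightarrow> real) \<Rightarrow> (real \<Rightarrow> real) \<Rightarrow> (real \<Rightarrow> real) \<Rightarrow> real \<Rightarrow>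
     (real \<Rightarrow> real \<Rightarrow> real) \<Rightarrow> bool" where
  "admissible_weak_solution \<alpha> f a u0 T u \<longleftrightarrow>
     bounded_measurable T u \<and>
     (if \<alpha> < 1 then
        entropy_inequality f u0 T u (\<lambda>t x. a x * (u t x / \<bar>u t x\<bar> powr \<alpha>))
      else
        (\<exists>h. (\<forall>t\<in>{0<..<T}. periodic1 (h t)) \<and>
             Linf (cylinder {0<..<T}) (\<lambda>(t, x). h t x) \<and>
             distributional_solution f T u h \<and>
             (AE (t, x) in cylinder {0<..<T}. h t x \<in> (\<lambda>s. a x * s) ` Sign (u t x)) \<and>
             entropy_inequality f u0 T u h))"

definition continuous_L1 :: "(real \<Rightarrow> real \<Rightarrow> real) \<Rightarrow> bool" where
  "continuous_L1 v \<longleftrightarrow>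
     (\<forall>t\<ge>0. periodic1 (v t) \<and> integrable torus (v t)) \<and>
     (\<forall>t\<ge>0. ((\<lambda>s. \<integral>x. \<bar>v s x - v t x\<bar> \<partial>torus) \<longlongrightarrow> 0) (at t within {0..}))"

text \<open>
  \<open>v\<close> is a continuous \<open>L\<^sup>1\<close>-valued representative of a global admissible weak solution \<open>w\<close>. Keeping
  \<open>v\<close> and \<open>w\<close> apart means that \<open>v\<close> itself need not be bounded on null sets.
\<close>

definition global_solution ::
    "real \<Rightarrow> (real \<Rightarrow> real) \<Rightarrow> (real \<Rightarrow> real) \<Rightarrow> (real \<Rightarrow> real) \<Rightarrow>
     (real \<Rightarrow> real \<Rightarrow> real) \<Rightarrow> bool" where
  "global_solution \<alpha> f a u0 v \<longleftrightarrow>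
     continuous_L1 v \<and>
     (\<exists>w. (\<forall>T>0. admissible_weak_solution \<alpha> f a u0 T w) \<and>
          (AE (t, x) in cylinder {0..}. v t x = w t x))"

end

theory Submission
  imports Defs
begin

text \<open>
  The solution dies because information travels around the torus. While \<open>\<bar>u\<bar> \<le> K\<close>, the
  characteristic speed \<open>f' u\<close> has a constant sign and is bounded away from zero, so every
  characteristic keeps returning to the interval \<open>\<omega>\<close> where \<open>a \<ge> \<delta>\<close>. Along a characteristic
  \<open>\<bar>u\<bar>\<^sup>\<alpha>\<close> has time derivative \<open>- \<alpha> a\<close> as long as \<open>u \<noteq> 0\<close>, hence loses at least a fixed amount
  during each turn and reaches zero in finite time.

  Averaging this over a turn amounts to a barrier. Choose a periodic \<open>\<phi>\<close> and \<open>c > 0\<close> such that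
  \<open>c - \<phi>' f' s \<le> \<alpha> a\<close> for all \<open>\<bar>s\<bar> \<le> K\<close>: along the flow \<open>\<phi>\<close> grows at rate at least \<open>c\<close> outside
  \<open>\<omega>\<close>, and the decrease inside \<open>\<omega>\<close>, which periodicity forces, is so slow that the damping pays
  for it. Formally, \<open>\<bar>u\<bar>\<^sup>\<alpha> + c t - \<phi>\<close> is then nonincreasing along characteristics wherever
  \<open>u \<noteq> 0\<close>. With \<open>\<bar>\<phi>\<bar> \<le> \<Phi>\<close> this leaves \<open>\<bar>u\<bar>\<^sup>\<alpha> \<le> K\<^sup>\<alpha> + 2 \<Phi> - c t\<close>, or \<open>u = 0\<close>.

  For entropy solutions this maximum principle follows from energy estimates with a large
  exponent \<open>p\<close>. The entropy \<open>E v = v\<^sup>2 exp (p \<bar>v\<bar>\<^sup>\<alpha>)\<close> is tested against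
  \<open>(T - t) exp (p (c t - \<phi> x))\<close>. Since \<open>E' v \<cdot> v / \<bar>v\<bar>\<^sup>\<alpha> \<ge> p \<alpha> E v\<close>, the choice of \<open>\<phi>\<close> makes the
  interior terms nonpositive, up to minus the integral of \<open>exp (p (c t - \<phi>)) E u\<close>
  (\<open>weighted_energy_estimate\<close>). That integral is therefore at most
  \<open>T exp (p \<Phi>) E K\<close>, and as \<open>p \<rightarrow> \<infinity>\<close> the function \<open>u\<close> has to vanish wherever
  \<open>\<bar>u\<bar>\<^sup>\<alpha> + c t - \<phi> > \<Phi> + K\<^sup>\<alpha>\<close> (\<open>vanishing_above_barrier\<close>). The argument is used twice: with
  \<open>\<phi> = 0\<close> and \<open>c = 0\<close> it gives \<open>\<bar>u\<bar> \<le> K\<close>, which is what confines the speeds to \<open>f' [-K, K]\<close>; then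
  with the weight of \<open>exists_torus_weight\<close> it gives extinction. The damping term \<open>h\<close>
  enters as a bounded function with \<open>a \<bar>u\<bar>\<^sup>2\<^sup>-\<^sup>\<alpha> \<le> u h\<close>, a form common to \<open>\<alpha> < 1\<close> and \<open>\<alpha> = 1\<close>.
\<close>

section \<open>Almost everywhere statements on the space-time cylinder\<close>

lemma AE_lborel_snd:
  assumes "AE x in (lborel :: real measure). P x"
  shows "AE p in (lborel :: (real \<times> real) measure). P (snd p)"
proof -
  obtain N where N: "{x. \<not> P x} \<subseteq> N" "emeasure lborel N = 0" "N \<in> sets (lborel :: real measure)"
    using assms by (auto elim!: AE_E)
  have "emeasure (lborel \<Otimes>\<^sub>M lborel) ((UNIV :: real set) \<times> N)
      = emeasure lborel (UNIV :: real set) * emeasure lborel N"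
    using N by (intro lborel.emeasure_pair_measure_Times) auto
  then have "AE p in (lborel \<Otimes>\<^sub>M lborel :: (real \<times> real) measure). P (snd p)"
    using N by (intro AE_I[where N = "UNIV \<times> N"]) (auto simp: space_pair_measure)
  then show ?thesis unfolding lborel_prod .
qed

text \<open>
  Measurability between the completed measures uses that the preimage of a null set is null.
  It is needed because the coefficient \<open>a\<close> is only Lebesgue measurable in \<open>x\<close> but has to be
  integrated over space-time.
\<close>

lemma measurable_snd_lebesgue:
  "(snd :: real \<times> real \<Rightarrow> real) \<in> lebesgue \<rightarrow>\<^sub>M lebesgue"
proof (rule completion.measurable_completion2)
  have "(snd :: real \<times> real \<Rightarrow> real) \<in> lborel \<rightarrow>\<^sub>M lborel"
    unfolding lborel_prod[symmetric] by simp
  then show m: "(snd :: real \<times> real \<Rightarrow> real) \<in> lebesgue \<rightarrow>\<^sub>M lborel"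
    by (rule measurable_completion)
  show "null_sets lborel \<subseteq> null_sets (distr (lebesgue :: (real \<times> real) measure) lborel snd)"
  proof
    fix N :: "real set" assume N: "N \<in> null_sets lborel"
    then have "AE p in (lborel :: (real \<times> real) measure). snd p \<notin> N"
      by (intro AE_lborel_snd AE_not_in)
    then have "AE p in (lebesgue :: (real \<times> real) measure). snd p \<notin> N"
      by (rule AE_completion)
    then have "snd -` N \<in> null_sets (lebesgue :: (real \<times> real) measure)"
      by (simp add: completion.AE_iff_null_sets vimage_def)
    then show "N \<in> null_sets (distr (lebesgue :: (real \<times> real) measure) lborel snd)"
      using N m by (subst null_sets_distr_iff) auto
  qed
qed

lemma sets_lebesgue_cylinder:
  fixes I :: "real set"
  assumes "I \<in> sets borel"
  shows "I \<times> {0..<1 :: real} \<in> sets lebesgue"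
proof -
  have "I \<times> {0..<1 :: real} \<in> sets (borel \<Otimes>\<^sub>M borel)"
    using assms by auto
  then show ?thesis
    unfolding borel_prod by (simp add: sets_completionI_sets)
qed

lemma AE_cylinder_iff:
  assumes "I \<in> sets borel"
  shows "(AE (t, x) in cylinder I. P t x) \<longleftrightarrow>
         (AE (t, x) in lebesgue. t \<in> I \<longrightarrow> 0 \<le> x \<and> x < 1 \<longrightarrow> P t x)"
  unfolding cylinder_def
  by (subst AE_restrict_space_iff)
     (use sets_lebesgue_cylinder[OF assms] in \<open>auto intro!: AE_cong\<close>)

lemma AE_torus_iff:
  "(AE x in torus. P x) \<longleftrightarrow> (AE x in lebesgue. 0 \<le> x \<and> x < 1 \<longrightarrow> P x)"
  unfolding torus_def by (subst AE_restrict_space_iff) (auto intro!: AE_cong)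

lemma AE_cylinder_of_AE_torus:
  assumes "AE x in torus. P x" and "I \<in> sets borel"
  shows "AE (t, x) in cylinder I. P x"
proof -
  have "AE x in lborel. 0 \<le> x \<and> x < 1 \<longrightarrow> P x"
    using assms(1) by (simp add: AE_torus_iff AE_completion_iff)
  then have "AE p in (lborel :: (real \<times> real) measure). 0 \<le> snd p \<and> snd p < 1 \<longrightarrow> P (snd p)"
    by (rule AE_lborel_snd)
  then have "AE p in (lebesgue :: (real \<times> real) measure). 0 \<le> snd p \<and> snd p < 1 \<longrightarrow> P (snd p)"
    by (rule AE_completion)
  then show ?thesis
    unfolding AE_cylinder_iff[OF assms(2)] by eventually_elim auto
qed

lemma AE_torus_slices_of_AE_cylinder:
  assumes "AE (t, x) in cylinder I. P t x" and "I \<in> sets borel"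
  shows "AE t in lborel. t \<in> I \<longrightarrow> (AE x in torus. P t x)"
proof -
  have "AE (t, x) in lborel \<Otimes>\<^sub>M lborel. t \<in> I \<longrightarrow> 0 \<le> x \<and> x < 1 \<longrightarrow> P t x"
    using assms unfolding AE_cylinder_iff[OF assms(2)] AE_completion_iff lborel_prod by simp
  then have "AE t in lborel. AE x in lborel. t \<in> I \<longrightarrow> 0 \<le> x \<and> x < 1 \<longrightarrow> P t x"
    by (auto dest: lborel_pair.AE_pair)
  then show ?thesis
    by eventually_elim (auto simp: AE_torus_iff AE_completion_iff)
qed

lemma measurable_cylinder_of_torus:
  fixes a :: "real \<Rightarrow> real"
  assumes "a \<in> borel_measurable torus" and "I \<in> sets borel"
  shows "(\<lambda>(t, x). a x) \<in> borel_measurable (cylinder I)"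
proof -
  have "(\<lambda>x. if x \<in> {0..<1} then a x else 0) \<in> borel_measurable lebesgue"
    using assms(1) unfolding torus_def by (intro borel_measurable_if_I) auto
  then have "(\<lambda>p::real \<times> real. if snd p \<in> {0..<1} then a (snd p) else 0) \<in> borel_measurable lebesgue"
    using measurable_compose[OF measurable_snd_lebesgue] by blast
  then have "(\<lambda>p::real \<times> real. if snd p \<in> {0..<1} then a (snd p) else 0) \<in> borel_measurable (cylinder I)"
    unfolding cylinder_def by (rule measurable_restrict_space1)
  then show ?thesis
    unfolding cylinder_def by (subst measurable_lebesgue_cong) auto
qed

lemma AE_time_neq:
  "AE p in (lebesgue :: (real \<times> real) measure). fst p \<noteq> (c :: real)"
proof -
  have "negligible {p :: real \<times> real. p \<bullet> (1, 0) = c}"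
    by (rule negligible_standard_hyperplane) (simp add: Basis_prod_def)
  then show ?thesis
    unfolding eventually_ae_filter_negligible by (intro exI[of _ "{p. p \<bullet> (1, 0) = c}"]) auto
qed

text \<open>
  The damping term of the case \<open>\<alpha> = 1\<close> is controlled for times in the open interval only, whereas the
  entropy inequality integrates over the closed one. The initial and the final slice are null
  sets, and the Lebesgue measure is complete.
\<close>

lemma AE_closed_cylinder:
  assumes "AE (t, x) in cylinder {0<..<T}. P t x"
  shows "AE (t, x) in cylinder {0..T}. P t x"
proof -
  have "AE (t, x) in lebesgue. t \<in> {0<..<T} \<longrightarrow> 0 \<le> x \<and> x < 1 \<longrightarrow> P t x"
    using assms by (subst (asm) AE_cylinder_iff) auto
  with AE_time_neq[of 0] AE_time_neq[of T]
  have "AE (t, x) in lebesgue. t \<in> {0..T} \<longrightarrow> 0 \<le> x \<and> x < 1 \<longrightarrow> P t x"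
    by eventually_elim auto
  then show ?thesis by (subst AE_cylinder_iff) auto
qed

lemma measurable_closed_cylinder:
  assumes "g \<in> borel_measurable (cylinder {0<..<T})"
  shows "(g :: real \<times> real \<Rightarrow> real) \<in> borel_measurable (cylinder {0..T})"
proof -
  let ?g = "\<lambda>p. if p \<in> {0<..<T} \<times> {0..<1} then g p else 0"
  let ?h = "\<lambda>p. if p \<in> {0..T} \<times> {0..<1} then g p else 0"
  have g: "?g \<in> borel_measurable lebesgue"
    using assms unfolding cylinder_def by (intro borel_measurable_if_I sets_lebesgue_cylinder) auto
  have "AE p in (lebesgue :: (real \<times> real) measure). ?g p = ?h p"
    using AE_time_neq[of 0] AE_time_neq[of T] by eventually_elim auto
  with g have "?h \<in> borel_measurable lebesgue"
    by (rule borel_measurable_AE)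
  then show ?thesis unfolding cylinder_def by (rule borel_measurable_if_D)
qed

lemma Linf_AE_bounded:
  assumes "Linf M g"
  obtains B where "AE x in M. \<bar>g x\<bar> \<le> B"
proof -
  have *: "AE x in M. ereal \<bar>g x\<bar> \<le> Linf_norm M g" "Linf_norm M g < \<infinity>"
    using assms esssup_AE[of "\<lambda>x. ereal \<bar>g x\<bar>" M] by (auto simp: Linf_def Linf_norm_def)
  then have "AE x in M. \<bar>g x\<bar> \<le> real_of_ereal (Linf_norm M g)"
    by (cases "Linf_norm M g") auto
  then show ?thesis by (rule that)
qed

lemma AE_lborel_exists_in_interval:
  fixes s t :: real
  assumes "AE x in lborel. P x" "s < t"
  obtains x where "s < x" "x < t" "P x"
proof -
  obtain N where N: "{x. \<not> P x} \<subseteq> N" "emeasure lborel N = 0" "N \<in> sets (lborel :: real measure)"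
    using assms(1) by (auto elim!: AE_E)
  have "\<not> {s<..<t} \<subseteq> N"
    using emeasure_mono[of "{s<..<t}" N lborel] N assms(2) by auto
  then obtain x where "x \<in> {s<..<t}" "x \<notin> N" by blast
  then show ?thesis using N(1) by (intro that[of x]) auto
qed

section \<open>An exponential entropy\<close>

text \<open>
  The factor \<open>exp (p \<bar>v\<bar>\<^sup>\<alpha>)\<close> solves \<open>E' \<cdot> v / \<bar>v\<bar>\<^sup>\<alpha> = p \<alpha> E\<close>, but has a cusp at \<open>0\<close> if \<open>\<alpha> < 1\<close>, where it
  is not convex, and a corner if \<open>\<alpha> = 1\<close>. The factor \<open>v\<^sup>2\<close> makes it convex and continuously
  differentiable and turns the equation into an inequality in the favourable direction.
\<close>

definition exp_entropy :: "real \<Rightarrow> real \<Rightarrow> real \<Rightarrow> real" where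
  "exp_entropy \<alpha> p v = v\<^sup>2 * exp (p * \<bar>v\<bar> powr \<alpha>)"

definition exp_entropy_deriv :: "real \<Rightarrow> real \<Rightarrow> real \<Rightarrow> real" where
  "exp_entropy_deriv \<alpha> p v = v * (2 + p * \<alpha> * \<bar>v\<bar> powr \<alpha>) * exp (p * \<bar>v\<bar> powr \<alpha>)"

lemma continuous_abs_powr:
  fixes \<alpha> :: real
  assumes "0 < \<alpha>"
  shows "continuous_on A (\<lambda>v::real. \<bar>v\<bar> powr \<alpha>)"
  using assms by (intro continuous_on_powr' continuous_intros) auto

lemma continuous_exp_entropy:
  "0 < \<alpha> \<Longrightarrow> continuous_on A (exp_entropy \<alpha> p)"
  unfolding exp_entropy_def by (intro continuous_intros continuous_abs_powr)

lemma continuous_exp_entropy_deriv: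
  "0 < \<alpha> \<Longrightarrow> continuous_on A (exp_entropy_deriv \<alpha> p)"
  unfolding exp_entropy_deriv_def by (intro continuous_intros continuous_abs_powr)

lemma exp_entropy_nonneg: "0 \<le> exp_entropy \<alpha> p v"
  by (simp add: exp_entropy_def)

lemma exp_entropy_deriv_sign:
  assumes "0 < \<alpha>" "0 \<le> p"
  shows "0 \<le> v \<Longrightarrow> 0 \<le> exp_entropy_deriv \<alpha> p v"
    and "v \<le> 0 \<Longrightarrow> exp_entropy_deriv \<alpha> p v \<le> 0"
  using assms by (auto simp: exp_entropy_deriv_def mult_le_0_iff zero_le_mult_iff add_nonneg_nonneg)

lemma exp_entropy_has_derivative_pos:
  assumes "0 < v"
  shows "(exp_entropy \<alpha> p has_real_derivative exp_entropy_deriv \<alpha> p v) (at v)"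
proof -
  have e: "\<alpha> * v powr (\<alpha> - 1) * v\<^sup>2 = v * (\<alpha> * v powr \<alpha>)"
    using assms by (simp add: powr_diff power2_eq_square)
  have "((\<lambda>v. v\<^sup>2 * exp (p * v powr \<alpha>)) has_real_derivative
      (2 * v) * exp (p * v powr \<alpha>) + v\<^sup>2 * (exp (p * v powr \<alpha>) * (p * (\<alpha> * v powr (\<alpha> - 1))))) (at v)"
    using assms by (auto intro!: derivative_eq_intros simp: field_simps powr_diff)
  also have "(2 * v) * exp (p * v powr \<alpha>) + v\<^sup>2 * (exp (p * v powr \<alpha>) * (p * (\<alpha> * v powr (\<alpha> - 1))))
      = (2 * v) * exp (p * v powr \<alpha>) + exp (p * v powr \<alpha>) * p * (\<alpha> * v powr (\<alpha> - 1) * v\<^sup>2)"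
    by (simp add: algebra_simps)
  also have "\<dots> = exp_entropy_deriv \<alpha> p v"
    unfolding e using assms by (simp add: exp_entropy_deriv_def algebra_simps)
  finally have d: "((\<lambda>v. v\<^sup>2 * exp (p * v powr \<alpha>)) has_real_derivative exp_entropy_deriv \<alpha> p v) (at v)" .
  show ?thesis
    using d by (rule has_field_derivative_transform_within_open[where S = "{0<..}"])
      (use assms in \<open>auto simp: exp_entropy_def\<close>)
qed

lemma exp_entropy_has_derivative:
  assumes "0 < \<alpha>"
  shows "(exp_entropy \<alpha> p has_real_derivative exp_entropy_deriv \<alpha> p v) (at v)"
proof (cases v "0::real" rule: linorder_cases)
  case greater
  then show ?thesis by (rule exp_entropy_has_derivative_pos)
next
  case less
  have "((\<lambda>v. exp_entropy \<alpha> p (- v)) has_real_derivative - exp_entropy_deriv \<alpha> p (- v)) (at v)"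
    using exp_entropy_has_derivative_pos[of "- v" \<alpha> p] less by (subst DERIV_mirror[symmetric]) auto
  then show ?thesis
    by (simp add: exp_entropy_def[abs_def] exp_entropy_deriv_def)
next
  case equal
  have c: "continuous_on UNIV (\<lambda>v::real. v * exp (p * \<bar>v\<bar> powr \<alpha>))"
    using assms by (intro continuous_intros continuous_abs_powr)
  have "((\<lambda>v::real. v * exp (p * \<bar>v\<bar> powr \<alpha>)) \<longlongrightarrow> 0) (at 0)"
    using c[unfolded continuous_on_def, rule_format, of 0] by simp
  moreover have "\<forall>\<^sub>F h in at 0. h * exp (p * \<bar>h\<bar> powr \<alpha>) =
      (exp_entropy \<alpha> p (0 + h) - exp_entropy \<alpha> p 0) / h"
    by (auto simp: eventually_at_filter exp_entropy_def power2_eq_square)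
  ultimately have "((\<lambda>h. (exp_entropy \<alpha> p (0 + h) - exp_entropy \<alpha> p 0) / h) \<longlongrightarrow> 0) (at 0)"
    by (rule Lim_transform_eventually)
  then show ?thesis
    using equal by (simp add: DERIV_def exp_entropy_deriv_def)
qed

text \<open>
  On the positive half-line the derivative is a product of nonnegative nondecreasing factors, and
  it is odd.
\<close>

lemma exp_entropy_deriv_mono:
  assumes "0 < \<alpha>" "0 \<le> p" "x \<le> y"
  shows "exp_entropy_deriv \<alpha> p x \<le> exp_entropy_deriv \<alpha> p y"
proof -
  have pos: "exp_entropy_deriv \<alpha> p x \<le> exp_entropy_deriv \<alpha> p y" if "0 \<le> x" "x \<le> y" for x y
  proof -
    have "\<bar>x\<bar> powr \<alpha> \<le> \<bar>y\<bar> powr \<alpha>"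
      using that assms by (intro powr_mono2) auto
    then have "p * \<bar>x\<bar> powr \<alpha> \<le> p * \<bar>y\<bar> powr \<alpha>" "p * \<alpha> * \<bar>x\<bar> powr \<alpha> \<le> p * \<alpha> * \<bar>y\<bar> powr \<alpha>"
      using assms by (auto intro!: mult_left_mono)
    then show ?thesis
      unfolding exp_entropy_deriv_def using that assms by (intro mult_mono add_mono) (auto intro: powr_mono2)
  qed
  have odd: "exp_entropy_deriv \<alpha> p (- v) = - exp_entropy_deriv \<alpha> p v" for v
    by (simp add: exp_entropy_deriv_def)
  consider "0 \<le> x" | "x \<le> 0" "0 \<le> y" | "y \<le> 0" by linarith
  then show ?thesis
  proof cases
    case 1 then show ?thesis using pos assms by auto
  next
    case 2 then show ?thesis using exp_entropy_deriv_sign[OF assms(1,2)] order_trans by blast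
  next
    case 3 then show ?thesis using pos[of "- y" "- x"] assms by (simp add: odd)
  qed
qed

lemma avg_deriv_eq:
  "(\<eta> has_real_derivative d) (at v) \<Longrightarrow> avg_deriv \<eta> v = d"
  by (auto simp: avg_deriv_def DERIV_imp_deriv real_differentiable_def)

lemma exp_entropy_pair:
  assumes "0 < \<alpha>" "0 \<le> p"
    and "\<And>v. (q has_real_derivative deriv f v * exp_entropy_deriv \<alpha> p v) (at v)"
  shows "entropy_pair f (exp_entropy \<alpha> p) q"
  unfolding entropy_pair_def
proof (intro conjI allI impI)
  show "convex_on UNIV (exp_entropy \<alpha> p)"
    using assms exp_entropy_has_derivative exp_entropy_deriv_mono
    by (intro convex_on_realI[where f' = "exp_entropy_deriv \<alpha> p"]) auto
  show "continuous_on UNIV q"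
    using assms(3) by (intro DERIV_continuous_on) (auto intro: has_field_derivative_at_within)
  show "(q has_real_derivative deriv f v * deriv (exp_entropy \<alpha> p) v) (at v)" for v
    using assms(3) DERIV_imp_deriv[OF exp_entropy_has_derivative[OF assms(1)]] by simp
qed

lemma continuous_has_antiderivative:
  fixes g :: "real \<Rightarrow> real"
  assumes "continuous_on UNIV g"
  obtains G where "\<And>x. (G has_real_derivative g x) (at x)" "G 0 = 0"
proof -
  have "\<exists>F. \<forall>x::real. (-\<infinity>::ereal) < x \<longrightarrow> x < (\<infinity>::ereal) \<longrightarrow> (F has_vector_derivative g x) (at x)"
    using assms by (intro einterval_antiderivative) (auto simp: continuous_on_eq_continuous_at)
  then obtain F where F: "\<And>x. (F has_real_derivative g x) (at x)"
    by (auto simp: has_real_derivative_iff_has_vector_derivative)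
  show ?thesis
    by (rule that[of "\<lambda>x. F x - F 0"]) (auto intro!: derivative_eq_intros F)
qed

text \<open>
  The left-hand side is \<open>\<integral> (c - d f' s) E' s ds\<close> over the segment from \<open>0\<close> to \<open>v\<close>, so a
  condition on the single speeds \<open>f' s\<close> passes to the entropy flux. It is applied with \<open>d = \<phi>' x\<close>.
\<close>

lemma exp_entropy_flux_bound:
  assumes "0 < \<alpha>" "0 \<le> p"
    and q: "\<And>v. (q has_real_derivative deriv f v * exp_entropy_deriv \<alpha> p v) (at v)" "q 0 = 0"
    and speed: "\<And>s. \<bar>s\<bar> \<le> \<bar>v\<bar> \<Longrightarrow> c - d * deriv f s \<le> A"
  shows "c * exp_entropy \<alpha> p v - d * q v \<le> A * exp_entropy \<alpha> p v"
proof -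
  define r where "r = (\<lambda>s. (A - c) * exp_entropy \<alpha> p s + d * q s)"
  have r: "(r has_real_derivative (A - c + d * deriv f s) * exp_entropy_deriv \<alpha> p s) (at s)" for s
    unfolding r_def
    by (auto intro!: derivative_eq_intros exp_entropy_has_derivative assms simp: algebra_simps)
  have r0: "r 0 = 0"
    by (simp add: r_def exp_entropy_def q)
  have "0 \<le> r v"
  proof (cases "0 \<le> v")
    case True
    have "r 0 \<le> r v"
    proof (rule DERIV_nonneg_imp_nondecreasing[OF True])
      fix s assume "0 \<le> s" "s \<le> v"
      then have "0 \<le> (A - c + d * deriv f s) * exp_entropy_deriv \<alpha> p s"
        using speed[of s] exp_entropy_deriv_sign[OF assms(1,2), of s] by (intro mult_nonneg_nonneg) auto
      with r show "\<exists>y. (r has_real_derivative y) (at s) \<and> 0 \<le> y" by blast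
    qed
    with r0 show ?thesis by simp
  next
    case False
    then have "v \<le> 0" by simp
    then have "r 0 \<le> r v"
    proof (rule DERIV_nonpos_imp_nonincreasing)
      fix s assume "v \<le> s" "s \<le> 0"
      then have "(A - c + d * deriv f s) * exp_entropy_deriv \<alpha> p s \<le> 0"
        using speed[of s] exp_entropy_deriv_sign[OF assms(1,2), of s] by (intro mult_nonneg_nonpos) auto
      with r show "\<exists>y. (r has_real_derivative y) (at s) \<and> y \<le> 0" by blast
    qed
    with r0 show ?thesis by simp
  qed
  then show ?thesis by (simp add: r_def algebra_simps)
qed

text \<open>
  The factor \<open>p\<close> gained here equals the one that differentiating the weight
  \<open>exp (p (c t - \<phi> x))\<close> produces; hence the condition on \<open>\<phi>\<close> and \<open>c\<close> does not depend on \<open>p\<close>.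
\<close>

lemma exp_entropy_damping:
  assumes "0 < \<alpha>" "0 \<le> p" "0 \<le> A" "A * \<bar>v\<bar> powr (2 - \<alpha>) \<le> v * h"
  shows "p * (\<alpha> * A * exp_entropy \<alpha> p v) \<le> exp_entropy_deriv \<alpha> p v * h"
proof -
  have v2: "\<bar>v\<bar> powr \<alpha> * \<bar>v\<bar> powr (2 - \<alpha>) = v\<^sup>2"
    by (cases "v = 0") (simp_all flip: powr_add)
  have vh: "0 \<le> v * h"
    using assms(3,4) by (meson mult_nonneg_nonneg order_trans powr_ge_zero)
  have "p * \<alpha> * \<bar>v\<bar> powr \<alpha> * (A * \<bar>v\<bar> powr (2 - \<alpha>)) \<le> p * \<alpha> * \<bar>v\<bar> powr \<alpha> * (v * h)"
    using assms by (intro mult_left_mono) auto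
  also have "\<dots> \<le> (2 + p * \<alpha> * \<bar>v\<bar> powr \<alpha>) * (v * h)"
    using vh by (intro mult_right_mono) auto
  finally have "p * \<alpha> * A * v\<^sup>2 \<le> (2 + p * \<alpha> * \<bar>v\<bar> powr \<alpha>) * (v * h)"
    by (simp flip: v2 add: mult_ac)
  then have "p * \<alpha> * A * v\<^sup>2 * exp (p * \<bar>v\<bar> powr \<alpha>) \<le> (2 + p * \<alpha> * \<bar>v\<bar> powr \<alpha>) * (v * h) * exp (p * \<bar>v\<bar> powr \<alpha>)"
    by (intro mult_right_mono) auto
  then show ?thesis
    by (simp add: exp_entropy_def exp_entropy_deriv_def mult_ac)
qed

section \<open>The weighted energy estimate\<close>

text \<open>
  The integrand of the entropy inequality is a sum of terms of this form. Integrability matters: the Bochner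
  integral of a function that is not integrable is \<open>0\<close>, and the entropy inequality would then carry
  no information.
\<close>

lemma integrable_on_cylinder:
  fixes g :: "real \<times> real \<times> real \<Rightarrow> real"
  assumes u: "bounded_measurable T u" and g: "continuous_on UNIV g"
    and h: "(\<lambda>(t, x). h t x) \<in> borel_measurable (cylinder {0..T})"
      "AE (t, x) in cylinder {0..T}. \<bar>h t x\<bar> \<le> H"
  shows "integrable (cylinder {0..T}) (\<lambda>(t, x). g (t, x, u t x) * h t x)"
proof -
  obtain M where M: "\<And>t x. t \<in> {0..T} \<Longrightarrow> \<bar>u t x\<bar> \<le> M"
    using u unfolding bounded_measurable_def by blast
  have "compact (g ` ({0..T} \<times> {0..1} \<times> {-M..M}))"
    by (intro compact_continuous_image continuous_on_subset[OF g] compact_Times) auto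
  then have "bounded (g ` ({0..T} \<times> {0..1} \<times> {-M..M}))"
    by (rule compact_imp_bounded)
  then obtain B where B: "\<And>p. p \<in> {0..T} \<times> {0..1} \<times> {-M..M} \<Longrightarrow> \<bar>g p\<bar> \<le> B"
    unfolding bounded_real by blast
  have S: "{0..T} \<times> {0..<1 :: real} \<in> lmeasurable"
    by (intro bounded_set_imp_lmeasurable bounded_Times sets_lebesgue_cylinder) auto
  interpret finite_measure "cylinder {0..T}"
    unfolding cylinder_def using S by (rule finite_measure_lebesgue_on)
  have id: "(\<lambda>p. p) \<in> borel_measurable (cylinder {0..T})"
    unfolding cylinder_def by (intro measurable_restrict_space1 measurable_completion) auto
  have [measurable]: "fst \<in> borel_measurable (cylinder {0..T})" "snd \<in> borel_measurable (cylinder {0..T})"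
    using measurable_compose[OF id, of fst borel] measurable_compose[OF id, of snd borel]
    by (auto simp flip: borel_prod)
  have [measurable]: "(\<lambda>p. u (fst p) (snd p)) \<in> borel_measurable (cylinder {0..T})"
    "(\<lambda>p. h (fst p) (snd p)) \<in> borel_measurable (cylinder {0..T})"
    using u h by (auto simp: bounded_measurable_def case_prod_beta')
  have "g \<in> borel_measurable borel"
    using g by (rule borel_measurable_continuous_onI)
  then have [measurable]: "g \<in> borel_measurable (borel \<Otimes>\<^sub>M borel \<Otimes>\<^sub>M borel)"
    by (simp add: borel_prod)
  have sp: "space (cylinder {0..T}) = {0..T} \<times> {0..<1}"
    by (simp add: cylinder_def)
  show ?thesis
  proof (rule integrable_const_bound[where B = "B * H"])
    show "(\<lambda>(t, x). g (t, x, u t x) * h t x) \<in> borel_measurable (cylinder {0..T})"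
      unfolding case_prod_beta' by measurable
    show "AE p in cylinder {0..T}. norm (case p of (t, x) \<Rightarrow> g (t, x, u t x) * h t x) \<le> B * H"
      using h(2) AE_space
    proof eventually_elim
      case (elim p)
      obtain t x where p: "p = (t, x)" by (cases p)
      have "\<bar>g (t, x, u t x)\<bar> \<le> B"
        using elim(2) M[of t x] unfolding sp p by (intro B) (auto simp: abs_le_iff)
      then show ?case
        using elim(1) by (auto simp: p abs_mult intro!: mult_mono order_trans[OF abs_ge_zero])
    qed
  qed
qed

lemma exp_weight_lipschitz:
  fixes \<phi> \<phi>' :: "real \<Rightarrow> real"
  assumes \<phi>: "\<And>x. (\<phi> has_real_derivative \<phi>' x) (at x)" "\<And>x. \<bar>\<phi> x\<bar> \<le> \<Phi>" "\<And>x. \<bar>\<phi>' x\<bar> \<le> D"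
    and p: "0 \<le> p" and T: "0 \<le> T"
  shows "\<exists>L. L-lipschitz_on ({0..T} \<times> UNIV) (\<lambda>(t, x). (T - t) * exp (p * (c * t - \<phi> x)))"
proof -
  define g where "g = (\<lambda>t::real. (T - t) * exp (p * (c * t)))"
  define k where "k = (\<lambda>x. exp (- (p * \<phi> x)))"
  define g' where "g' = (\<lambda>t. - exp (p * (c * t)) + (T - t) * (exp (p * (c * t)) * (p * c)))"
  have g': "(g has_real_derivative g' t) (at t within {0..T})" for t
    unfolding g_def g'_def by (auto intro!: derivative_eq_intros)
  have "compact (g' ` {0..T})" "compact (g ` {0..T})"
    unfolding g_def g'_def by (auto intro!: compact_continuous_image continuous_intros)
  then have "bounded (g' ` {0..T})" "bounded (g ` {0..T})"
    by (auto intro: compact_imp_bounded)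
  then obtain B C where "\<forall>y\<in>g' ` {0..T}. \<bar>y\<bar> \<le> B" "\<forall>y\<in>g ` {0..T}. \<bar>y\<bar> \<le> C"
    unfolding bounded_real by blast
  then have B: "\<bar>g' t\<bar> \<le> B" and C: "\<bar>g t\<bar> \<le> C" if "t \<in> {0..T}" for t
    using that by blast+
  have B0: "0 \<le> B" "0 \<le> C" using B[of 0] C[of 0] T by auto
  have k_le: "\<bar>k x\<bar> \<le> exp (p * \<Phi>)" for x
  proof -
    have "p * - \<phi> x \<le> p * \<Phi>"
      using \<phi>(2)[of x] p by (intro mult_left_mono) auto
    then show ?thesis by (simp add: k_def)
  qed
  have k': "(k has_real_derivative k x * - (p * \<phi>' x)) (at x within UNIV)" for x
    unfolding k_def by (auto intro!: derivative_eq_intros \<phi>(1))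
  have D0: "0 \<le> D" using \<phi>(3)[of 0] by linarith
  have k'_le: "norm (k x * - (p * \<phi>' x)) \<le> exp (p * \<Phi>) * (p * D)" for x
  proof -
    have "\<bar>k x\<bar> * (p * \<bar>\<phi>' x\<bar>) \<le> exp (p * \<Phi>) * (p * D)"
      using k_le \<phi>(3) p by (intro mult_mono mult_left_mono) auto
    then show ?thesis using p by (simp add: abs_mult)
  qed
  have g_lip: "\<bar>g s - g t\<bar> \<le> B * \<bar>s - t\<bar>" if "s \<in> {0..T}" "t \<in> {0..T}" for s t
    using field_differentiable_bound[of "{0..T}" g g' B s t] g' B that by simp
  have k_lip: "\<bar>k x - k y\<bar> \<le> exp (p * \<Phi>) * (p * D) * \<bar>x - y\<bar>" for x y
    using field_differentiable_bound[of UNIV k "\<lambda>x. k x * - (p * \<phi>' x)" "exp (p * \<Phi>) * (p * D)" x y] k' k'_le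
    by simp
  let ?L = "B * exp (p * \<Phi>) + C * (exp (p * \<Phi>) * (p * D))"
  have "?L-lipschitz_on ({0..T} \<times> UNIV) (\<lambda>(t, x). g t * k x)"
  proof (rule lipschitz_onI)
    fix P Q :: "real \<times> real" assume "P \<in> {0..T} \<times> UNIV" "Q \<in> {0..T} \<times> UNIV"
    then obtain s x t y where PQ: "P = (s, x)" "Q = (t, y)" "s \<in> {0..T}" "t \<in> {0..T}" by auto
    have d: "\<bar>s - t\<bar> \<le> dist P Q" "\<bar>x - y\<bar> \<le> dist P Q"
      using dist_fst_le[of P Q] dist_snd_le[of P Q] by (auto simp: PQ dist_real_def)
    have "g s * k x - g t * k y = (g s - g t) * k x + g t * (k x - k y)"
      by (simp add: algebra_simps)
    also have "\<bar>\<dots>\<bar> \<le> \<bar>g s - g t\<bar> * \<bar>k x\<bar> + \<bar>g t\<bar> * \<bar>k x - k y\<bar>"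
      by (metis abs_mult abs_triangle_ineq)
    also have "\<dots> \<le> (B * dist P Q) * exp (p * \<Phi>) + C * (exp (p * \<Phi>) * (p * D) * dist P Q)"
    proof (intro add_mono mult_mono)
      show "\<bar>g s - g t\<bar> \<le> B * dist P Q"
        using g_lip[OF PQ(3,4)] mult_left_mono[OF d(1) B0(1)] by linarith
      show "\<bar>k x - k y\<bar> \<le> exp (p * \<Phi>) * (p * D) * dist P Q"
        using k_lip by (rule order_trans) (use d(2) p D0 in \<open>intro mult_left_mono, auto\<close>)
    qed (use B0 k_le C PQ in auto)
    finally show "dist ((\<lambda>(t, x). g t * k x) P) ((\<lambda>(t, x). g t * k x) Q) \<le> ?L * dist P Q"
      by (simp add: PQ dist_real_def algebra_simps)
  qed (use B0 D0 p in auto)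
  moreover have "(\<lambda>(t, x). g t * k x) = (\<lambda>(t, x). (T - t) * exp (p * (c * t - \<phi> x)))"
    by (auto simp: g_def k_def fun_eq_iff right_diff_distrib exp_diff exp_minus divide_inverse)
  ultimately show ?thesis by auto
qed

text \<open>
  The condition \<open>speed\<close> says that \<open>c t - \<phi> x\<close> never grows faster along a characteristic than
  \<open>\<bar>u\<bar>\<^sup>\<alpha>\<close> is damped, at the speed of any state between \<open>- \<bar>u\<bar>\<close> and \<open>\<bar>u\<bar>\<close>. Under it,
  everything that the weight and the flux contribute is absorbed by the damping. The cut-off
  \<open>T - t\<close> contributes minus the integral that is to be estimated.
\<close>

lemma weighted_energy_estimate:
  fixes f a u0 :: "real \<Rightarrow> real" and u h :: "real \<Rightarrow> real \<Rightarrow> real" and \<phi> \<phi>' :: "real \<Rightarrow> real"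
  assumes \<alpha>: "0 < \<alpha>" and f: "continuous_on UNIV (deriv f)"
    and \<phi>: "\<And>x. (\<phi> has_real_derivative \<phi>' x) (at x)" "continuous_on UNIV \<phi>'" "periodic1 \<phi>"
      "\<And>x. \<bar>\<phi> x\<bar> \<le> \<Phi>" "\<And>x. \<bar>\<phi>' x\<bar> \<le> D"
    and T: "0 < T" and p: "0 \<le> p" and K: "0 \<le> K" and a: "\<And>x. 0 \<le> a x"
    and u: "bounded_measurable T u"
    and h: "(\<lambda>(t, x). h t x) \<in> borel_measurable (cylinder {0..T})"
      "AE (t, x) in cylinder {0..T}. \<bar>h t x\<bar> \<le> H"
      "AE (t, x) in cylinder {0..T}. a x * \<bar>u t x\<bar> powr (2 - \<alpha>) \<le> u t x * h t x"
    and entropy: "entropy_inequality f u0 T u h"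
    and u0: "AE x in torus. \<bar>u0 x\<bar> \<le> K"
    and speed: "AE (t, x) in cylinder {0..T}.
        \<forall>s. \<bar>s\<bar> \<le> \<bar>u t x\<bar> \<longrightarrow> c - \<phi>' x * deriv f s \<le> \<alpha> * a x"
  shows "integrable (cylinder {0..T}) (\<lambda>(t, x). exp (p * (c * t - \<phi> x)) * exp_entropy \<alpha> p (u t x))"
    and "(\<integral>(t, x). exp (p * (c * t - \<phi> x)) * exp_entropy \<alpha> p (u t x) \<partial>cylinder {0..T})
      \<le> T * exp (p * \<Phi>) * exp_entropy \<alpha> p K"
proof -
  let ?E = "exp_entropy \<alpha> p" and ?E' = "exp_entropy_deriv \<alpha> p"
  let ?C = "cylinder {0..T}"
  obtain q where q: "\<And>v. (q has_real_derivative deriv f v * ?E' v) (at v)" "q 0 = 0"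
    using continuous_has_antiderivative[of "\<lambda>v. deriv f v * ?E' v"]
      continuous_on_mult[OF f continuous_exp_entropy_deriv[OF \<alpha>]] by blast
  have q_cont: "continuous_on UNIV q"
    using q(1) by (intro DERIV_continuous_on) (auto intro: has_field_derivative_at_within)
  have \<phi>_cont: "continuous_on UNIV \<phi>"
    using \<phi>(1) by (intro DERIV_continuous_on) (auto intro: has_field_derivative_at_within)
  define e where "e = (\<lambda>t x. exp (p * (c * t - \<phi> x)))"
  define \<psi> where "\<psi> = (\<lambda>t x. (T - t) * e t x)"
  have dt: "dt \<psi> t x = - e t x + p * c * \<psi> t x" for t x
    unfolding dt_def \<psi>_def e_def
    by (rule DERIV_imp_deriv) (auto intro!: derivative_eq_intros simp: algebra_simps)
  have dx: "dx \<psi> t x = - (p * \<phi>' x * \<psi> t x)" for t x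
    unfolding dx_def \<psi>_def e_def
    by (rule DERIV_imp_deriv) (auto intro!: derivative_eq_intros \<phi>(1) simp: algebra_simps)
  define F where "F = (\<lambda>(t, x). dt \<psi> t x * ?E (u t x) + dx \<psi> t x * q (u t x)
                       - \<psi> t x * avg_deriv ?E (u t x) * h t x)"
  have "0 \<le> (\<integral>p. F p \<partial>?C) + (\<integral>x. \<psi> 0 x * ?E (u0 x) \<partial>torus)"
  proof -
    have "entropy_pair f ?E q"
      by (rule exp_entropy_pair) (use \<alpha> p q in auto)
    moreover have "\<forall>t\<in>{0..T}. periodic1 (\<psi> t)"
      using \<phi>(3) by (auto simp: periodic1_def \<psi>_def e_def)
    moreover have "\<exists>L. L-lipschitz_on ({0..T} \<times> UNIV) (\<lambda>(t, x). \<psi> t x)"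
      unfolding \<psi>_def e_def using exp_weight_lipschitz[OF \<phi>(1,4,5) p] T by simp
    moreover have "\<forall>t\<in>{0..T}. \<forall>x. 0 \<le> \<psi> t x" "\<forall>x. \<psi> T x = 0"
      by (auto simp: \<psi>_def e_def)
    ultimately show ?thesis
      using entropy unfolding entropy_inequality_def F_def by blast
  qed
  moreover have "(\<integral>x. \<psi> 0 x * ?E (u0 x) \<partial>torus) \<le> T * exp (p * \<Phi>) * ?E K"
  proof -
    have fin: "finite_measure torus"
      unfolding torus_def by (rule finite_measure_lebesgue_on) (auto intro: bounded_set_imp_lmeasurable)
    have "(\<integral>x. \<psi> 0 x * ?E (u0 x) \<partial>torus) \<le> (\<integral>x. T * exp (p * \<Phi>) * ?E K \<partial>torus)"
    proof (rule integral_mono_AE')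
      show "integrable torus (\<lambda>x. T * exp (p * \<Phi>) * ?E K)"
        by (rule finite_measure.integrable_const[OF fin])
      show "AE x in torus. \<psi> 0 x * ?E (u0 x) \<le> T * exp (p * \<Phi>) * ?E K"
        using u0
      proof eventually_elim
        case (elim x)
        have "p * \<bar>u0 x\<bar> powr \<alpha> \<le> p * \<bar>K\<bar> powr \<alpha>"
          using elim p \<alpha> K by (intro mult_left_mono powr_mono2) auto
        moreover have "(u0 x)\<^sup>2 \<le> K\<^sup>2"
          using elim K by (simp add: abs_le_square_iff[symmetric])
        ultimately have "?E (u0 x) \<le> ?E K"
          unfolding exp_entropy_def by (intro mult_mono) auto
        moreover have "- (p * \<phi> x) \<le> p * \<Phi>"
          using \<phi>(4)[of x] p mult_left_mono[of "- \<phi> x" \<Phi> p] by auto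
        then have "\<psi> 0 x \<le> T * exp (p * \<Phi>)"
          using T by (auto simp: \<psi>_def e_def intro!: mult_left_mono)
        ultimately show ?case
          using T exp_entropy_nonneg by (intro mult_mono) (auto simp: \<psi>_def e_def)
      qed
    qed (use T exp_entropy_nonneg in auto)
    then show ?thesis
      by (simp add: torus_def measure_restrict_space)
  qed
  moreover
  have cont: "continuous_on UNIV (\<lambda>(t, x, v). e t x * ?E v)"
    unfolding e_def case_prod_beta'
    by (intro continuous_intros continuous_on_compose2[OF \<phi>_cont]
        continuous_on_compose2[OF continuous_exp_entropy[OF \<alpha>]]) auto
  have one: "(\<lambda>(t, x). 1 :: real) \<in> borel_measurable ?C" "AE (t, x) in ?C. \<bar>1 :: real\<bar> \<le> 1"
    by auto
  have G: "integrable ?C (\<lambda>(t, x). e t x * ?E (u t x))"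
    using integrable_on_cylinder[OF u cont, where h = "\<lambda>_ _. 1", OF one] by simp
  have "(\<integral>p. F p \<partial>?C) \<le> (\<integral>p. - (case p of (t, x) \<Rightarrow> e t x * ?E (u t x)) \<partial>?C)"
  proof (rule integral_mono_AE)
    have "continuous_on UNIV (\<lambda>(t, x, v). (- e t x + p * c * \<psi> t x) * ?E v - p * \<phi>' x * \<psi> t x * q v)"
      unfolding \<psi>_def e_def case_prod_beta'
      by (intro continuous_intros continuous_on_compose2[OF \<phi>_cont] continuous_on_compose2[OF \<phi>(2)]
          continuous_on_compose2[OF q_cont] continuous_on_compose2[OF continuous_exp_entropy[OF \<alpha>]]) auto
    from integrable_on_cylinder[OF u this, where h = "\<lambda>_ _. 1", OF one]
    have i1: "integrable ?C (\<lambda>(t, x). (- e t x + p * c * \<psi> t x) * ?E (u t x) - p * \<phi>' x * \<psi> t x * q (u t x))"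
      by simp
    have "continuous_on UNIV (\<lambda>(t, x, v). \<psi> t x * ?E' v)"
      unfolding \<psi>_def e_def case_prod_beta'
      by (intro continuous_intros continuous_on_compose2[OF \<phi>_cont]
          continuous_on_compose2[OF continuous_exp_entropy_deriv[OF \<alpha>]]) auto
    from integrable_on_cylinder[OF u this h(1,2)]
    have i2: "integrable ?C (\<lambda>(t, x). \<psi> t x * ?E' (u t x) * h t x)"
      by simp
    show "integrable ?C F"
      using Bochner_Integration.integrable_diff[OF i1 i2]
      unfolding F_def dt dx avg_deriv_eq[OF exp_entropy_has_derivative[OF \<alpha>]]
      by (simp add: case_prod_beta')
    show "integrable ?C (\<lambda>p. - (case p of (t, x) \<Rightarrow> e t x * ?E (u t x)))"
      using G by simp
    show "AE p in ?C. F p \<le> - (case p of (t, x) \<Rightarrow> e t x * ?E (u t x))"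
      using speed h(3) AE_space
    proof eventually_elim
      case (elim P)
      obtain t x where P: "P = (t, x)" by (cases P)
      have t: "0 \<le> \<psi> t x"
        using elim(3) by (auto simp: P cylinder_def \<psi>_def e_def)
      have "p * (c * ?E (u t x) - \<phi>' x * q (u t x)) \<le> p * (\<alpha> * a x * ?E (u t x))"
        using exp_entropy_flux_bound[OF \<alpha> p q] elim(1) p by (auto simp: P intro!: mult_left_mono)
      also have "\<dots> \<le> ?E' (u t x) * h t x"
        using exp_entropy_damping[OF \<alpha> p a] elim(2) by (auto simp: P)
      finally have "\<psi> t x * (p * (c * ?E (u t x) - \<phi>' x * q (u t x))) \<le> \<psi> t x * (?E' (u t x) * h t x)"
        using t by (rule mult_left_mono)
      then show ?case
        unfolding F_def P dt dx avg_deriv_eq[OF exp_entropy_has_derivative[OF \<alpha>]]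
        by (simp add: algebra_simps)
    qed
  qed
  ultimately show "(\<integral>(t, x). exp (p * (c * t - \<phi> x)) * exp_entropy \<alpha> p (u t x) \<partial>cylinder {0..T})
      \<le> T * exp (p * \<Phi>) * exp_entropy \<alpha> p K"
    by (simp add: e_def)
  show "integrable (cylinder {0..T}) (\<lambda>(t, x). exp (p * (c * t - \<phi> x)) * exp_entropy \<alpha> p (u t x))"
    using G by (simp add: e_def)
qed

section \<open>A weight that decreases along characteristics only inside the damping region\<close>

lemma periodic1_of_int:
  assumes "periodic1 g"
  shows "g (x - of_int n) = g x"
proof -
  have nat: "g (y + real m) = g y" for y m
  proof (induction m)
    case (Suc m)
    have "g (y + real (Suc m)) = g (y + real m + 1)" by (simp add: ac_simps)
    also have "\<dots> = g y" using assms Suc by (simp add: periodic1_def)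
    finally show ?case .
  qed simp
  show ?thesis
  proof (cases "0 \<le> n")
    case True
    then show ?thesis using nat[of "x - of_int n" "nat n"] by simp
  next
    case False
    then show ?thesis using nat[of x "nat (- n)"] by simp
  qed
qed

lemma periodic1_bounded:
  assumes "periodic1 g" "continuous_on UNIV g"
  obtains B where "\<And>x. \<bar>g x\<bar> \<le> B"
proof -
  have "bounded (g ` {0..1})"
    using assms(2) by (intro compact_imp_bounded compact_continuous_image)
      (auto intro: continuous_on_subset)
  then obtain B where B: "\<forall>y\<in>g ` {0..1}. \<bar>y\<bar> \<le> B"
    unfolding bounded_real by blast
  have "\<bar>g x\<bar> \<le> B" for x
  proof -
    have "x - of_int \<lfloor>x\<rfloor> \<in> {0..1}"
      by (simp, linarith)
    then have "\<bar>g (x - of_int \<lfloor>x\<rfloor>)\<bar> \<le> B" using B by blast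
    then show ?thesis by (simp add: periodic1_of_int[OF assms(1)])
  qed
  then show ?thesis by (rule that)
qed

text \<open>
  A cosine cut off at the level that it takes at distance \<open>\<rho>\<close> from the midpoint is periodic and
  continuous by itself, and positive only near the integer translates of the midpoint. Truncating
  \<open>\<rho>\<close> at \<open>1 / 2\<close> covers intervals longer than a period.
\<close>

lemma exists_periodic_bump:
  fixes l r :: real
  assumes "l < r"
  obtains b where "periodic1 b" "continuous_on UNIV b" "\<And>x. 0 \<le> b x" "\<And>x. b x \<le> 2"
    "0 < b ((l + r) / 2)" "\<And>x. b x \<noteq> 0 \<Longrightarrow> \<exists>n::int. x - of_int n \<in> {l<..<r}"
proof -
  define x0 where "x0 = (l + r) / 2"
  define \<rho> where "\<rho> = min ((r - l) / 2) (1 / 2)"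
  define b where "b = (\<lambda>x. max 0 (cos (2 * pi * (x - x0)) - cos (2 * pi * \<rho>)))"
  have \<rho>: "0 < \<rho>" "\<rho> \<le> 1 / 2" "\<rho> \<le> (r - l) / 2"
    unfolding \<rho>_def using assms by (simp_all only: min_less_iff_conj min.cobounded1 min.cobounded2) auto
  have shift: "cos (2 * pi * (x - of_int n)) = cos (2 * pi * x)" for x and n :: int
    using cos.minus_of_int[of "2 * pi * x" n] by (simp add: algebra_simps)
  show ?thesis
  proof (rule that[of b])
    show "periodic1 b"
    proof -
      have "cos (2 * pi * (x + 1 - x0)) = cos (2 * pi * (x - x0))" for x
        using shift[of "x - x0" "- 1"] by (simp add: algebra_simps)
      then show ?thesis by (simp add: periodic1_def b_def)
    qed
    show "continuous_on UNIV b"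
      unfolding b_def by (intro continuous_intros)
    show "0 \<le> b x" "b x \<le> 2" for x
      using cos_le_one[of "2 * pi * (x - x0)"] cos_ge_minus_one[of "2 * pi * \<rho>"]
      unfolding b_def by linarith+
    have "cos (2 * pi * \<rho>) < cos 0"
      using \<rho> by (intro cos_monotone_0_pi) auto
    then show "0 < b ((l + r) / 2)"
      by (simp add: b_def x0_def)
    show "\<exists>n::int. x - of_int n \<in> {l<..<r}" if "b x \<noteq> 0" for x
    proof -
      define n where "n = round (x - x0)"
      define y where "y = x - x0 - of_int n"
      have y: "\<bar>y\<bar> \<le> 1 / 2"
        using of_int_round_abs_le[of "x - x0"] by (simp add: y_def n_def abs_minus_commute)
      have "cos (2 * pi * \<rho>) < cos (2 * pi * (x - x0))"
        using that by (auto simp: b_def max_def split: if_splits)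
      also have "\<dots> = cos (2 * pi * y)"
        unfolding y_def by (simp add: shift)
      also have "\<dots> = cos (2 * pi * \<bar>y\<bar>)"
        by (cases "0 \<le> y") auto
      finally have cos_y: "cos (2 * pi * \<rho>) < cos (2 * pi * \<bar>y\<bar>)" .
      have "\<not> \<rho> \<le> \<bar>y\<bar>"
      proof
        assume "\<rho> \<le> \<bar>y\<bar>"
        then have "cos (2 * pi * \<bar>y\<bar>) \<le> cos (2 * pi * \<rho>)"
          using mult_left_mono[OF y, of "2 * pi"] \<rho>
          by (intro cos_monotone_0_pi_le mult_left_mono) auto
        with cos_y show False by simp
      qed
      then have "\<bar>y\<bar> < (r - l) / 2"
        using \<rho> by simp
      then have "x - of_int n \<in> {l<..<r}"
        by (auto simp: y_def x0_def abs_less_iff field_simps)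
      then show ?thesis ..
    qed
  qed
qed

text \<open>
  A periodic function cannot increase everywhere. Here the decrease is concentrated in the integer
  translates of \<open>{l<..<r}\<close>: outside of them the slope is the constant \<open>\<mu>\<close>, the mean of the bump \<open>b\<close>,
  and subtracting \<open>b\<close> from this slope restores periodicity.
\<close>

lemma exists_torus_weight:
  fixes l r :: real
  assumes "l < r"
  obtains \<phi> b \<mu> where "0 < \<mu>" "\<And>x. (\<phi> has_real_derivative \<mu> - b x) (at x)" "periodic1 \<phi>"
    "periodic1 b" "continuous_on UNIV b" "\<And>x. 0 \<le> b x" "\<And>x. b x \<le> 2"
    "\<And>x. b x \<noteq> 0 \<Longrightarrow> \<exists>n::int. x - of_int n \<in> {l<..<r}"
proof -
  define x0 where "x0 = (l + r) / 2"
  obtain b where b: "periodic1 b" "continuous_on UNIV b" "\<And>x. 0 \<le> b x" "\<And>x. b x \<le> 2"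
    "0 < b x0" "\<And>x. b x \<noteq> 0 \<Longrightarrow> \<exists>n::int. x - of_int n \<in> {l<..<r}"
    using exists_periodic_bump[OF assms] unfolding x0_def by metis
  obtain G where G: "\<And>x. (G has_real_derivative b x) (at x)"
    using continuous_has_antiderivative[OF b(2)] by metis
  define \<mu> where "\<mu> = G 1 - G 0"
  have "((\<lambda>x. G (x + 1) - G x) has_real_derivative 0) (at x)" for x
    using DERIV_shift[THEN iffD1, OF G[of "x + 1"]] b(1)
    by (auto intro!: derivative_eq_intros G simp: periodic1_def)
  then have period: "G (x + 1) - G x = \<mu>" for x
    using DERIV_isconst_all[of "\<lambda>x. G (x + 1) - G x" x 0] by (simp add: \<mu>_def)
  have mono: "G x \<le> G y" if "x \<le> y" for x y
    using that by (rule DERIV_nonneg_imp_nondecreasing) (use G b(3) in blast)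
  \<comment> \<open>Otherwise the nondecreasing \<open>G\<close> would be constant near \<open>x0\<close>, where its slope is positive.\<close>
  have "0 < \<mu>"
  proof (rule ccontr)
    assume "\<not> 0 < \<mu>"
    then have const: "G y = G x0" if "x0 - 1 \<le> y" "y \<le> x0 + 1" for y
      using period[of "x0 - 1"] period[of x0] mono[of "x0 - 1" x0] mono[of x0 "x0 + 1"]
        mono[OF that(1)] mono[OF that(2)] by simp
    have "(G has_real_derivative 0) (at x0)"
      by (rule has_field_derivative_transform_within_open[where S = "{x0 - 1<..<x0 + 1}"
            and f = "\<lambda>_. G x0"]) (auto intro: const[symmetric])
    with G[of x0] have "b x0 = 0" by (rule DERIV_unique)
    with b(5) show False by simp
  qed
  moreover have "((\<lambda>x. \<mu> * x - G x) has_real_derivative \<mu> - b x) (at x)" for x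
    by (auto intro!: derivative_eq_intros G)
  moreover have "periodic1 (\<lambda>x. \<mu> * x - G x)"
    using period by (simp add: periodic1_def algebra_simps)
  ultimately show ?thesis
    using that b by metis
qed

section \<open>Extinction\<close>

text \<open>
  Where \<open>w > 0\<close> the weights \<open>exp (n w)\<close> exceed \<open>n w\<close>, so the bound, which does not depend on \<open>n\<close>,
  leaves no room for a positive integral of \<open>g max 0 w\<close>.
\<close>

lemma AE_eq_0_of_exp_integral_bound:
  fixes g w :: "'a \<Rightarrow> real"
  assumes g: "\<And>z. 0 \<le> g z"
    and [measurable]: "g \<in> borel_measurable M" "w \<in> borel_measurable M"
    and int: "\<And>n. 0 < n \<Longrightarrow> integrable M (\<lambda>z. g z * exp (real n * w z))"
    and bound: "\<And>n. 0 < n \<Longrightarrow> (\<integral>z. g z * exp (real n * w z) \<partial>M) \<le> D"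
  shows "AE z in M. 0 < w z \<longrightarrow> g z = 0"
proof -
  define m where "m = (\<lambda>z. g z * max 0 (w z))"
  have le: "real n * m z \<le> g z * exp (real n * w z)" for n z
  proof -
    have "real n * max 0 (w z) \<le> exp (real n * w z)"
    proof (cases "0 \<le> w z")
      case True
      have "real n * w z \<le> exp (real n * w z)"
        using exp_ge_add_one_self[of "real n * w z"] by linarith
      with True show ?thesis by (simp add: max_def)
    qed (simp add: max_def)
    from mult_left_mono[OF this g[of z]] show ?thesis by (simp add: m_def mult_ac)
  qed
  have m0: "0 \<le> m z" for z
    using g by (simp add: m_def)
  have m_int: "integrable M m"
  proof (rule Bochner_Integration.integrable_bound[OF int[of 1]])
    show "m \<in> borel_measurable M" unfolding m_def by measurable
    show "AE z in M. norm (m z) \<le> norm (g z * exp (real 1 * w z))"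
      using le[of 1] m0 g by (auto simp: abs_mult)
  qed simp
  have "real n * integral\<^sup>L M m \<le> D" if "0 < n" for n
  proof -
    have "real n * integral\<^sup>L M m = (\<integral>z. real n * m z \<partial>M)" by simp
    also have "\<dots> \<le> (\<integral>z. g z * exp (real n * w z) \<partial>M)"
      by (rule integral_mono) (use m_int int that le in auto)
    finally show ?thesis using bound[OF that] by simp
  qed
  moreover have "\<exists>n>0. D < real n * integral\<^sup>L M m" if pos: "0 < integral\<^sup>L M m"
  proof -
    obtain n where n: "D < real n * integral\<^sup>L M m"
      using ex_less_of_nat_mult[OF pos] by blast
    also have "\<dots> \<le> real (Suc n) * integral\<^sup>L M m"
      using pos by (intro mult_right_mono) auto
    finally show ?thesis by blast
  qed
  ultimately have "\<not> 0 < integral\<^sup>L M m"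
    using not_le by blast
  moreover have "0 \<le> integral\<^sup>L M m"
    using m0 by simp
  ultimately have "integral\<^sup>L M m = 0" by simp
  then have "AE z in M. m z = 0"
    using m_int m0 by (subst (asm) integral_nonneg_eq_0_iff_AE) auto
  then show ?thesis
    by eventually_elim (auto simp: m_def max_def)
qed

text \<open>
  Divided by \<open>exp (p (\<Phi> + K\<^sup>\<alpha>))\<close>, the energy estimate reads \<open>\<integral> u\<^sup>2 exp (p w) \<le> T K\<^sup>2\<close> with \<open>w\<close>
  the excess over the barrier; then \<open>p\<close> runs through the natural numbers.
\<close>

lemma vanishing_above_barrier:
  fixes f a u0 :: "real \<Rightarrow> real" and u h :: "real \<Rightarrow> real \<Rightarrow> real" and \<phi> \<phi>' :: "real \<Rightarrow> real"
  assumes \<alpha>: "0 < \<alpha>" and f: "continuous_on UNIV (deriv f)"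
    and \<phi>: "\<And>x. (\<phi> has_real_derivative \<phi>' x) (at x)" "continuous_on UNIV \<phi>'" "periodic1 \<phi>"
      "\<And>x. \<bar>\<phi> x\<bar> \<le> \<Phi>" "\<And>x. \<bar>\<phi>' x\<bar> \<le> D"
    and T: "0 < T" and K: "0 \<le> K" and a: "\<And>x. 0 \<le> a x"
    and u: "bounded_measurable T u"
    and h: "(\<lambda>(t, x). h t x) \<in> borel_measurable (cylinder {0..T})"
      "AE (t, x) in cylinder {0..T}. \<bar>h t x\<bar> \<le> H"
      "AE (t, x) in cylinder {0..T}. a x * \<bar>u t x\<bar> powr (2 - \<alpha>) \<le> u t x * h t x"
    and entropy: "entropy_inequality f u0 T u h"
    and u0: "AE x in torus. \<bar>u0 x\<bar> \<le> K"
    and speed: "AE (t, x) in cylinder {0..T}.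
        \<forall>s. \<bar>s\<bar> \<le> \<bar>u t x\<bar> \<longrightarrow> c - \<phi>' x * deriv f s \<le> \<alpha> * a x"
  shows "AE (t, x) in cylinder {0..T}.
    \<Phi> + K powr \<alpha> < c * t - \<phi> x + \<bar>u t x\<bar> powr \<alpha> \<longrightarrow> u t x = 0"
proof -
  let ?C = "cylinder {0..T}"
  define w where "w = (\<lambda>(t, x). c * t - \<phi> x + \<bar>u t x\<bar> powr \<alpha> - (\<Phi> + K powr \<alpha>))"
  define g where "g = (\<lambda>(t, x). (u t x)\<^sup>2)"
  have eq: "g z * exp (real n * w z) = exp (- (real n * (\<Phi> + K powr \<alpha>))) *
      (case z of (t, x) \<Rightarrow> exp (real n * (c * t - \<phi> x)) * exp_entropy \<alpha> (real n) (u t x))" for n z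
    by (cases z) (simp add: g_def w_def exp_entropy_def algebra_simps flip: exp_add)
  note energy = weighted_energy_estimate[OF \<alpha> f \<phi> T of_nat_0_le_iff K a u h entropy u0 speed]
  have meas: "(\<lambda>(t, x). k (t, x, u t x)) \<in> borel_measurable ?C"
    if "continuous_on UNIV k" for k :: "real \<times> real \<times> real \<Rightarrow> real"
    using integrable_on_cylinder[OF u that, of "\<lambda>_ _. 1" 1] by (simp add: borel_measurable_integrable)
  have \<phi>_cont: "continuous_on UNIV \<phi>"
    using \<phi>(1) by (intro DERIV_continuous_on) (auto intro: has_field_derivative_at_within)
  have "AE z in ?C. 0 < w z \<longrightarrow> g z = 0"
  proof (rule AE_eq_0_of_exp_integral_bound[where D = "T * K\<^sup>2"])
    show "0 \<le> g z" for z
      by (cases z) (simp add: g_def)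
    have "continuous_on UNIV (\<lambda>(t, x, v). v\<^sup>2 :: real)"
      unfolding case_prod_beta' by (intro continuous_intros)
    from meas[OF this] show "g \<in> borel_measurable ?C"
      by (simp add: g_def)
    have "continuous_on UNIV (\<lambda>(t, x, v). c * t - \<phi> x + \<bar>v\<bar> powr \<alpha> - (\<Phi> + K powr \<alpha>))"
      unfolding case_prod_beta'
      by (intro continuous_intros continuous_on_compose2[OF \<phi>_cont]
          continuous_on_compose2[OF continuous_abs_powr[OF \<alpha>]]) auto
    from meas[OF this] show "w \<in> borel_measurable ?C"
      by (simp add: w_def)
    show "integrable ?C (\<lambda>z. g z * exp (real n * w z))" for n
      unfolding eq by (intro integrable_mult_right energy(1))
    show "(\<integral>z. g z * exp (real n * w z) \<partial>?C) \<le> T * K\<^sup>2" for n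
    proof -
      have "(\<integral>z. g z * exp (real n * w z) \<partial>?C)
          \<le> exp (- (real n * (\<Phi> + K powr \<alpha>))) * (T * exp (real n * \<Phi>) * exp_entropy \<alpha> (real n) K)"
        unfolding eq integral_mult_right_zero by (intro mult_left_mono energy(2)) simp
      also have "\<dots> = T * K\<^sup>2 *
          (exp (- (real n * (\<Phi> + K powr \<alpha>))) * exp (real n * \<Phi>) * exp (real n * K powr \<alpha>))"
        using K by (simp add: exp_entropy_def mult_ac)
      also have "\<dots> = T * K\<^sup>2"
        by (simp add: distrib_left flip: exp_add)
      finally show ?thesis .
    qed
  qed
  then show ?thesis
    by eventually_elim (auto simp: w_def g_def)
qed

text \<open>
  Both definitions of a weak solution provide a damping term with the same three properties. For
  \<open>\<alpha> = 1\<close> this rests on \<open>u s = \<bar>u\<bar>\<close> for every \<open>s \<in> Sign u\<close>, also at \<open>u = 0\<close>.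
\<close>

lemma admissible_weak_solution_damping:
  assumes \<alpha>: "\<alpha> \<le> 1" and A: "condition_A a"
    and u: "admissible_weak_solution \<alpha> f a u0 T u"
  obtains h H where "(\<lambda>(t, x). h t x) \<in> borel_measurable (cylinder {0..T})"
      "AE (t, x) in cylinder {0..T}. \<bar>h t x\<bar> \<le> H"
      "AE (t, x) in cylinder {0..T}. a x * \<bar>u t x\<bar> powr (2 - \<alpha>) \<le> u t x * h t x"
      "entropy_inequality f u0 T u h"
proof (cases "\<alpha> < 1")
  case True
  define h where "h = (\<lambda>t x. a x * (u t x / \<bar>u t x\<bar> powr \<alpha>))"
  have bm: "bounded_measurable T u"
    using u by (simp add: admissible_weak_solution_def)
  then obtain M where M: "\<And>t x. t \<in> {0..T} \<Longrightarrow> \<bar>u t x\<bar> \<le> M"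
    unfolding bounded_measurable_def by blast
  have La: "Linf torus a" and a0: "\<And>x. 0 \<le> a x"
    using A by (auto simp: condition_A_def)
  obtain B where B: "AE x in torus. \<bar>a x\<bar> \<le> B"
    using Linf_AE_bounded[OF La] .
  have [measurable]: "(\<lambda>z. u (fst z) (snd z)) \<in> borel_measurable (cylinder {0..T})"
    using bm by (simp add: bounded_measurable_def case_prod_beta')
  have "a \<in> borel_measurable torus"
    using La by (simp add: Linf_def)
  from measurable_cylinder_of_torus[OF this, of "{0..T}"]
  have [measurable]: "(\<lambda>z. a (snd z)) \<in> borel_measurable (cylinder {0..T})"
    by (simp add: case_prod_beta')
  have powr: "\<bar>v / \<bar>v\<bar> powr \<alpha>\<bar> = \<bar>v\<bar> powr (1 - \<alpha>)" "v * (v / \<bar>v\<bar> powr \<alpha>) = \<bar>v\<bar> powr (2 - \<alpha>)"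
    for v :: real
    by (cases "v = 0"; simp add: powr_diff power2_eq_square)+
  show ?thesis
  proof (rule that[of h])
    show "(\<lambda>(t, x). h t x) \<in> borel_measurable (cylinder {0..T})"
      unfolding h_def case_prod_beta' by measurable
    show "AE (t, x) in cylinder {0..T}. \<bar>h t x\<bar> \<le> B * M powr (1 - \<alpha>)"
      using AE_cylinder_of_AE_torus[OF B, of "{0..T}", simplified] AE_space
    proof eventually_elim
      case (elim z)
      obtain t x where z: "z = (t, x)" by (cases z)
      have "\<bar>u t x\<bar> \<le> M"
        using elim by (intro M) (auto simp: z cylinder_def)
      then have "\<bar>u t x\<bar> powr (1 - \<alpha>) \<le> M powr (1 - \<alpha>)"
        using \<alpha> by (intro powr_mono2) auto
      then have "\<bar>a x\<bar> * \<bar>u t x / \<bar>u t x\<bar> powr \<alpha>\<bar> \<le> B * M powr (1 - \<alpha>)"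
        unfolding powr using elim(1) by (intro mult_mono) (auto simp: z)
      then show ?case
        by (simp add: z h_def abs_mult)
    qed
    show "AE (t, x) in cylinder {0..T}. a x * \<bar>u t x\<bar> powr (2 - \<alpha>) \<le> u t x * h t x"
    proof -
      have "a x * \<bar>u t x\<bar> powr (2 - \<alpha>) = u t x * h t x" for t x
        unfolding h_def powr(2)[symmetric] by (simp only: mult_ac)
      then show ?thesis by simp
    qed
    show "entropy_inequality f u0 T u h"
      using u True by (simp add: admissible_weak_solution_def h_def)
  qed
next
  case False
  then obtain h where h: "Linf (cylinder {0<..<T}) (\<lambda>(t, x). h t x)"
      "AE (t, x) in cylinder {0<..<T}. h t x \<in> (\<lambda>s. a x * s) ` Sign (u t x)"
      "entropy_inequality f u0 T u h"
    using u by (auto simp: admissible_weak_solution_def)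
  obtain H where "AE z in cylinder {0<..<T}. \<bar>case z of (t, x) \<Rightarrow> h t x\<bar> \<le> H"
    using Linf_AE_bounded[OF h(1)] .
  then have H: "AE (t, x) in cylinder {0<..<T}. \<bar>h t x\<bar> \<le> H"
    by (simp add: case_prod_beta')
  have "\<alpha> = 1" using False \<alpha> by simp
  have "AE (t, x) in cylinder {0<..<T}. a x * \<bar>u t x\<bar> powr (2 - \<alpha>) \<le> u t x * h t x"
    using h(2)
  proof eventually_elim
    case (elim z)
    obtain t x where z: "z = (t, x)" by (cases z)
    obtain s where s: "s \<in> Sign (u t x)" "h t x = a x * s"
      using elim by (auto simp: z)
    have "u t x * s = \<bar>u t x\<bar>"
      using s(1) by (auto simp: Sign_def split: if_splits)
    then have "u t x * h t x = a x * \<bar>u t x\<bar>"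
      by (simp add: s(2) mult.left_commute)
    then show ?case by (simp add: z \<open>\<alpha> = 1\<close>)
  qed
  with h H show ?thesis
    by (intro that[of h H] measurable_closed_cylinder AE_closed_cylinder) (auto simp: Linf_def)
qed

text \<open>
  Fubini's theorem gives vanishing of almost all slices only. Such times exist immediately after
  \<open>t\<close>, and the \<open>L\<^sup>1\<close>-continuity from the right carries the conclusion over to \<open>t\<close>.
\<close>

lemma continuous_L1_vanishes:
  assumes v: "continuous_L1 v" and ae: "AE (t, x) in cylinder {0..}. T \<le> t \<longrightarrow> v t x = 0"
    and t: "0 \<le> t" "T \<le> t"
  shows "AE x in torus. v t x = 0"
proof -
  define I where "I = (\<integral>x. \<bar>v t x\<bar> \<partial>torus)"
  have int: "integrable torus (v s)" if "0 \<le> s" for s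
    using v that by (simp add: continuous_L1_def)
  have "\<not> 0 < I"
  proof
    assume "0 < I"
    have "((\<lambda>s. \<integral>x. \<bar>v s x - v t x\<bar> \<partial>torus) \<longlongrightarrow> 0) (at t within {0..})"
      using v t by (simp add: continuous_L1_def)
    from tendstoD[OF this \<open>0 < I\<close>] obtain d where d: "0 < d"
      "\<And>s. 0 \<le> s \<Longrightarrow> s \<noteq> t \<Longrightarrow> dist s t < d \<Longrightarrow> \<bar>\<integral>x. \<bar>v s x - v t x\<bar> \<partial>torus\<bar> < I"
      by (auto simp: eventually_at)
    have slices: "AE s in lborel. s \<in> {0..} \<longrightarrow> (AE x in torus. T \<le> s \<longrightarrow> v s x = 0)"
      using ae by (rule AE_torus_slices_of_AE_cylinder) simp
    obtain s where s: "t < s" "s < t + d" "s \<in> {0..} \<longrightarrow> (AE x in torus. T \<le> s \<longrightarrow> v s x = 0)"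
      using AE_lborel_exists_in_interval[OF slices, of t "t + d"] d(1)
      by (metis less_add_same_cancel1)
    have "AE x in torus. \<bar>v s x - v t x\<bar> = \<bar>v t x\<bar>"
      using s t by auto
    then have "(\<integral>x. \<bar>v s x - v t x\<bar> \<partial>torus) = I"
      unfolding I_def using int[of s] int[of t] s t
      by (intro integral_cong_AE) (auto intro!: borel_measurable_integrable integrable_abs
          Bochner_Integration.integrable_diff)
    with d(2)[of s] s t show False by (auto simp: dist_real_def)
  qed
  then have "I = 0"
    unfolding I_def by (simp add: order_antisym not_less)
  then have "AE x in torus. \<bar>v t x\<bar> = 0"
    unfolding I_def using int[of t] t by (subst (asm) integral_nonneg_eq_0_iff_AE) auto
  then show ?thesis by simp
qed

text \<open>
  The condition \<open>speed\<close> is required for states in \<open>[-K, K]\<close> only. This suffices because the barrier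
  argument with the trivial weight \<open>\<phi> = 0\<close>, \<open>c = 0\<close>, for which all speeds are admissible, first
  yields \<open>\<bar>u\<bar> \<le> K\<close>.
\<close>

lemma admissible_weak_solution_extinction:
  fixes f a u0 \<phi> \<phi>' :: "real \<Rightarrow> real"
  assumes \<alpha>: "0 < \<alpha>" "\<alpha> \<le> 1" and f: "continuous_on UNIV (deriv f)" and A: "condition_A a"
    and K: "0 \<le> K" and u0: "AE x in torus. \<bar>u0 x\<bar> \<le> K"
    and \<phi>: "\<And>x. (\<phi> has_real_derivative \<phi>' x) (at x)" "continuous_on UNIV \<phi>'" "periodic1 \<phi>"
      "\<And>x. \<bar>\<phi> x\<bar> \<le> \<Phi>" "\<And>x. \<bar>\<phi>' x\<bar> \<le> D"
    and speed: "\<And>x s. \<bar>s\<bar> \<le> K \<Longrightarrow> c - \<phi>' x * deriv f s \<le> \<alpha> * a x"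
    and T: "0 < T" and u: "admissible_weak_solution \<alpha> f a u0 T u"
  shows "AE (t, x) in cylinder {0..T}. 2 * \<Phi> + K powr \<alpha> < c * t \<longrightarrow> u t x = 0"
proof -
  obtain h H where h: "(\<lambda>(t, x). h t x) \<in> borel_measurable (cylinder {0..T})"
      "AE (t, x) in cylinder {0..T}. \<bar>h t x\<bar> \<le> H"
      "AE (t, x) in cylinder {0..T}. a x * \<bar>u t x\<bar> powr (2 - \<alpha>) \<le> u t x * h t x"
      "entropy_inequality f u0 T u h"
    using admissible_weak_solution_damping[OF \<alpha>(2) A u] .
  have bm: "bounded_measurable T u"
    using u by (simp add: admissible_weak_solution_def)
  have a0: "0 \<le> a x" for x
    using A by (simp add: condition_A_def)
  have "AE (t, x) in cylinder {0..T}. 0 + K powr \<alpha> < 0 * t - 0 + \<bar>u t x\<bar> powr \<alpha> \<longrightarrow> u t x = 0"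
    by (rule vanishing_above_barrier[where \<phi> = "\<lambda>_. 0" and \<phi>' = "\<lambda>_. 0" and D = 0,
          OF \<alpha>(1) f _ _ _ _ _ T K a0 bm h u0])
      (use \<alpha> a0 in \<open>auto simp: periodic1_def\<close>)
  then have bound: "AE (t, x) in cylinder {0..T}. \<bar>u t x\<bar> \<le> K"
  proof eventually_elim
    case (elim z)
    obtain t x where z: "z = (t, x)" by (cases z)
    have "K powr \<alpha> < \<bar>u t x\<bar> powr \<alpha>" if "K < \<bar>u t x\<bar>"
      using that K \<alpha> by (intro powr_less_mono2) auto
    then show ?case
      using elim K by (force simp: z)
  qed
  then have "AE (t, x) in cylinder {0..T}.
      \<forall>s. \<bar>s\<bar> \<le> \<bar>u t x\<bar> \<longrightarrow> c - \<phi>' x * deriv f s \<le> \<alpha> * a x"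
    by eventually_elim (use speed in force)
  from vanishing_above_barrier[OF \<alpha>(1) f \<phi> T K a0 bm h u0 this]
  show ?thesis
  proof eventually_elim
    case (elim z)
    obtain t x where z: "z = (t, x)" by (cases z)
    have "\<Phi> + K powr \<alpha> < c * t - \<phi> x + \<bar>u t x\<bar> powr \<alpha>" if "2 * \<Phi> + K powr \<alpha> < c * t"
      using that \<phi>(4)[of x] powr_ge_zero[of "\<bar>u t x\<bar>" \<alpha>] by linarith
    then show ?case using elim by (auto simp: z)
  qed
qed

theorem theorem1p8:
  fixes \<alpha> K :: real and f a :: "real \<Rightarrow> real"
  assumes "0 < \<alpha>" and "\<alpha> \<le> 1"
    and "smooth f" and "deriv f 0 \<noteq> 0"
    and "condition_A a"
    and "\<exists>l r \<delta>. l < r \<and> 0 < \<delta> \<and> (\<forall>x\<in>{l<..<r}. \<delta> \<le> a x)"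
    and "0 \<le> K" and "0 < (INF s\<in>{-K..K}. \<bar>deriv f s\<bar>)"
  shows "\<forall>u0. periodic1 u0 \<and> Linf torus u0 \<and> Linf_norm torus u0 \<le> ereal K \<longrightarrow>
           (\<exists>T>0. \<forall>u. global_solution \<alpha> f a u0 u \<longrightarrow>
              (\<forall>t\<ge>T. AE x in torus. u t x = 0))"
proof (intro allI impI)
  fix u0 assume u0: "periodic1 u0 \<and> Linf torus u0 \<and> Linf_norm torus u0 \<le> ereal K"
  have f: "continuous_on UNIV (deriv f)"
    using \<open>smooth f\<close>[unfolded smooth_def, rule_format, of 1]
    by (simp add: differentiable_imp_continuous_on)
  have a: "periodic1 a" "\<And>x. 0 \<le> a x"
    using \<open>condition_A a\<close> by (auto simp: condition_A_def)
  obtain l r \<delta> where lr: "l < r" "0 < \<delta>" "\<And>x. x \<in> {l<..<r} \<Longrightarrow> \<delta> \<le> a x"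
    using assms(6) by blast
  obtain \<phi> b \<mu> where w: "0 < \<mu>" "\<And>x. (\<phi> has_real_derivative \<mu> - b x) (at x)" "periodic1 \<phi>"
    "periodic1 b" "continuous_on UNIV b" "\<And>x. 0 \<le> b x" "\<And>x. b x \<le> 2"
    "\<And>x. b x \<noteq> 0 \<Longrightarrow> \<exists>n::int. x - of_int n \<in> {l<..<r}"
    using exists_torus_weight[OF lr(1)] by metis
  define m where "m = (INF s\<in>{-K..K}. \<bar>deriv f s\<bar>)"
  have "0 < m" unfolding m_def by (fact assms(8))
  have m: "m \<le> \<bar>deriv f s\<bar>" if "\<bar>s\<bar> \<le> K" for s
    unfolding m_def using that by (intro cINF_lower bdd_belowI2[of _ 0]) (auto simp: abs_le_iff)
  have "bounded (deriv f ` {-K..K})"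
    by (intro compact_imp_bounded compact_continuous_image continuous_on_subset[OF f]) auto
  then obtain C where "\<forall>y\<in>deriv f ` {-K..K}. \<bar>y\<bar> \<le> C"
    unfolding bounded_real by blast
  then have C: "\<bar>deriv f s\<bar> \<le> C" if "\<bar>s\<bar> \<le> K" for s
    using that by (auto simp: abs_le_iff)
  have "0 < C"
    using m[of 0] C[of 0] \<open>0 < m\<close> \<open>0 \<le> K\<close> by auto
  \<comment> \<open>The direction in which the characteristics turn around the torus; the weight is reflected accordingly.\<close>
  define \<sigma> where "\<sigma> = sgn (deriv f 0)"
  have \<sigma>: "\<sigma> * deriv f s = \<bar>deriv f s\<bar>" if "\<bar>s\<bar> \<le> K" for s
  proof -
    have "connected (deriv f ` {-K..K})"
      by (intro connected_continuous_image continuous_on_subset[OF f]) auto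
    moreover have "0 \<notin> deriv f ` {-K..K}"
      using m \<open>0 < m\<close> by (fastforce simp: abs_le_iff)
    moreover have "deriv f s \<in> deriv f ` {-K..K}" "deriv f 0 \<in> deriv f ` {-K..K}"
      using that by (auto simp: abs_le_iff)
    ultimately have "\<not> (deriv f s < 0 \<and> 0 < deriv f 0)" "\<not> (deriv f 0 < 0 \<and> 0 < deriv f s)"
      by (meson connectedD_interval less_imp_le)+
    then show ?thesis
      using \<open>deriv f 0 \<noteq> 0\<close> by (auto simp: \<sigma>_def sgn_if)
  qed
  \<comment> \<open>Small enough for the damping in \<open>\<omega>\<close> to pay for the decrease of the weight: \<open>\<epsilon> b \<bar>f'\<bar> \<le> 2 \<epsilon> C = \<alpha> \<delta>\<close>.\<close>
  define \<epsilon> where "\<epsilon> = \<alpha> * \<delta> / (2 * C)"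
  have "0 < \<epsilon>" using \<open>0 < \<alpha>\<close> \<open>0 < C\<close> lr(2) by (simp add: \<epsilon>_def)
  \<comment> \<open>A lower bound for the rate at which \<open>\<phi>1\<close> grows along characteristics outside \<open>\<omega>\<close>.\<close>
  define c where "c = \<epsilon> * \<mu> * m"
  have "0 < c" using \<open>0 < \<epsilon>\<close> \<open>0 < m\<close> w(1) by (simp add: c_def)
  define \<phi>1 where "\<phi>1 = (\<lambda>x. \<sigma> * \<epsilon> * \<phi> x)"
  define \<phi>1' where "\<phi>1' = (\<lambda>x. \<sigma> * \<epsilon> * (\<mu> - b x))"
  have d\<phi>: "(\<phi>1 has_real_derivative \<phi>1' x) (at x)" for x
    unfolding \<phi>1_def \<phi>1'_def by (intro DERIV_cmult w(2))
  have c\<phi>': "continuous_on UNIV \<phi>1'"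
    unfolding \<phi>1'_def by (intro continuous_intros w(5))
  have c\<phi>: "continuous_on UNIV \<phi>1"
    using d\<phi> by (intro DERIV_continuous_on) (auto intro: has_field_derivative_at_within)
  have p\<phi>: "periodic1 \<phi>1" "periodic1 \<phi>1'"
    using w(3,4) by (auto simp: periodic1_def \<phi>1_def \<phi>1'_def)
  obtain \<Phi> where \<Phi>: "\<And>x. \<bar>\<phi>1 x\<bar> \<le> \<Phi>"
    using periodic1_bounded[OF p\<phi>(1) c\<phi>] by blast
  obtain D where D: "\<And>x. \<bar>\<phi>1' x\<bar> \<le> D"
    using periodic1_bounded[OF p\<phi>(2) c\<phi>'] by blast
  have speed: "c - \<phi>1' x * deriv f s \<le> \<alpha> * a x" if s: "\<bar>s\<bar> \<le> K" for x s
  proof -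
    have "c \<le> \<epsilon> * \<mu> * \<bar>deriv f s\<bar>"
      unfolding c_def using m[OF s] \<open>0 < \<epsilon>\<close> w(1) by (intro mult_left_mono) auto
    moreover have "\<phi>1' x * deriv f s = \<epsilon> * \<mu> * \<bar>deriv f s\<bar> - \<epsilon> * b x * \<bar>deriv f s\<bar>"
      unfolding \<phi>1'_def \<sigma>[OF s, symmetric] by (simp add: algebra_simps)
    ultimately have "c - \<phi>1' x * deriv f s \<le> \<epsilon> * b x * \<bar>deriv f s\<bar>"
      by simp
    also have "\<dots> \<le> \<alpha> * a x"
    proof (cases "b x = 0")
      case True
      then show ?thesis using a(2) \<open>0 < \<alpha>\<close> by simp
    next
      case False
      then obtain n :: int where "x - of_int n \<in> {l<..<r}"
        using w(8) by blast
      from lr(3)[OF this] have "\<delta> \<le> a x"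
        by (simp add: periodic1_of_int[OF a(1)])
      have "\<epsilon> * b x * \<bar>deriv f s\<bar> \<le> \<epsilon> * 2 * C"
        using \<open>0 < \<epsilon>\<close> w(6,7) C[OF s] by (intro mult_mono mult_left_mono) auto
      also have "\<dots> = \<alpha> * \<delta>"
        using \<open>0 < C\<close> by (simp add: \<epsilon>_def)
      also have "\<dots> \<le> \<alpha> * a x"
        using \<open>\<delta> \<le> a x\<close> \<open>0 < \<alpha>\<close> by simp
      finally show ?thesis .
    qed
    finally show ?thesis .
  qed
  \<comment> \<open>The summand \<open>1\<close> makes the time positive and the inequality \<open>late\<close> strict.\<close>
  define T where "T = (2 * \<Phi> + K powr \<alpha>) / c + 1"
  have "0 \<le> \<Phi>" using \<Phi>[of 0] by linarith
  then have "0 < T" using \<open>0 < c\<close> by (simp add: T_def add_nonneg_pos)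
  have late: "2 * \<Phi> + K powr \<alpha> < c * t" if "T \<le> t" for t
  proof -
    have "(2 * \<Phi> + K powr \<alpha>) / c < t" using that by (simp add: T_def)
    then show ?thesis using \<open>0 < c\<close> by (simp add: divide_less_eq mult.commute)
  qed
  have u0K: "AE x in torus. \<bar>u0 x\<bar> \<le> K"
  proof -
    have "AE x in torus. ereal \<bar>u0 x\<bar> \<le> Linf_norm torus u0"
      unfolding Linf_norm_def by (rule esssup_AE)
    then show ?thesis
    proof eventually_elim
      case (elim x)
      then have "ereal \<bar>u0 x\<bar> \<le> ereal K" using u0 order_trans by blast
      then show ?case by simp
    qed
  qed
  show "\<exists>T>0. \<forall>u. global_solution \<alpha> f a u0 u \<longrightarrow> (\<forall>t\<ge>T. AE x in torus. u t x = 0)"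
  proof (intro exI[of _ T] conjI allI impI)
    fix v t assume v: "global_solution \<alpha> f a u0 v" and t: "T \<le> t"
    then obtain w where w: "\<And>T. 0 < T \<Longrightarrow> admissible_weak_solution \<alpha> f a u0 T w"
      and vw: "AE (t, x) in cylinder {0..}. v t x = w t x"
      by (auto simp: global_solution_def)
    have "AE (t, x) in lebesgue. t \<in> {0..real (Suc n)} \<longrightarrow> 0 \<le> x \<and> x < 1 \<longrightarrow> T \<le> t \<longrightarrow> w t x = 0" for n
    proof -
      have "AE (t, x) in cylinder {0..real (Suc n)}. 2 * \<Phi> + K powr \<alpha> < c * t \<longrightarrow> w t x = 0"
        by (rule admissible_weak_solution_extinction[OF assms(1,2) f \<open>condition_A a\<close> \<open>0 \<le> K\<close> u0K
              d\<phi> c\<phi>' p\<phi>(1) \<Phi> D speed _ w]) auto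
      then have "AE (t, x) in cylinder {0..real (Suc n)}. T \<le> t \<longrightarrow> w t x = 0"
        by eventually_elim (use late in auto)
      then show ?thesis by (subst (asm) AE_cylinder_iff) auto
    qed
    then have "AE z in lebesgue. \<forall>n. (case z of (t, x) \<Rightarrow>
        t \<in> {0..real (Suc n)} \<longrightarrow> 0 \<le> x \<and> x < 1 \<longrightarrow> T \<le> t \<longrightarrow> w t x = 0)"
      unfolding AE_all_countable by simp
    moreover have "AE (t, x) in lebesgue. t \<in> {0..} \<longrightarrow> 0 \<le> x \<and> x < 1 \<longrightarrow> v t x = w t x"
      using vw by (subst (asm) AE_cylinder_iff) auto
    ultimately have "AE (t, x) in lebesgue. t \<in> {0..} \<longrightarrow> 0 \<le> x \<and> x < 1 \<longrightarrow> T \<le> t \<longrightarrow> v t x = 0"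
    proof eventually_elim
      case (elim z)
      obtain t x where z: "z = (t, x)" by (cases z)
      obtain n where "t \<le> real n" using real_arch_simple by blast
      then have "t \<le> real (Suc n)" by simp
      then show ?case using elim(1)[rule_format, of n] elim by (auto simp: z)
    qed
    then have "AE (t, x) in cylinder {0..}. T \<le> t \<longrightarrow> v t x = 0"
      by (subst AE_cylinder_iff) auto
    then show "AE x in torus. v t x = 0"
      using v t \<open>0 < T\<close> by (intro continuous_L1_vanishes[of v T]) (auto simp: global_solution_def)
  qed (fact \<open>0 < T\<close>)
qed

end
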